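(* There exists an infinite word over a 2-letter alphabet that simultaneously avoids the five formulas with reversal $xyzyx\cdot zyxy^Rz$, $xyzyx\cdot zy^Rxyz$, $xyzyx\cdot zy^Rxy^Rz$, $xyzy^Rx\cdot zyxy^Rz$, and $xyzy^Rx\cdot zy^Rxyz$.
   Context: A formula with reversal is a finite set of words (called fragments, written separated by dots) over an alphabet of variables, where each variable $x$ may occur either as $x$ or as $x^R$. An occurrence of a formula with reversal $F$ in a word $w$ is a map $h$ assigning to each variable a nonempty word, extended to fragments by concatenation with the convention $h(x^R)=h(x)^R$ (the reverse, i.e. mirror image, of $h(x)$), such that $h(f)$ is a factor of $w$ for every fragment $f$ of $F$. A word avoids $F$ if it contains no occurrence of $F$. *)

theory Defs
  imports "HOL-Library.Omega_Words_Fun" "HOL-Library.FSet"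
begin

text \<open>A symbol is an occurrence of a variable, either plain (\<open>Fwd x\<close> for \<open>x\<close>) or reversed
  (\<open>Rev x\<close> for \<open>x\<^sup>R\<close>).\<close>

datatype 'v symbol = Fwd 'v | Rev 'v

type_synonym 'v fragment = "'v symbol list"

type_synonym 'v formula = "'v fragment fset"

fun subst_symbol :: "('v \<Rightarrow> 'a list) \<Rightarrow> 'v symbol \<Rightarrow> 'a list" where
  "subst_symbol h (Fwd x) = h x"
| "subst_symbol h (Rev x) = rev (h x)"

definition subst_fragment :: "('v \<Rightarrow> 'a list) \<Rightarrow> 'v fragment \<Rightarrow> 'a list" where
  "subst_fragment h f = concat (map (subst_symbol h) f)"

definition is_factor :: "'a list \<Rightarrow> 'a word \<Rightarrow> bool" where
  "is_factor u w \<longleftrightarrow> (\<exists>i j. i \<le> j \<and> u = w [i \<rightarrow> j])"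

definition is_occurrence :: "('v \<Rightarrow> 'a list) \<Rightarrow> 'v formula \<Rightarrow> 'a word \<Rightarrow> bool" where
  "is_occurrence h F w \<longleftrightarrow>
     (\<forall>x. h x \<noteq> []) \<and> (\<forall>f. f |\<in>| F \<longrightarrow> is_factor (subst_fragment h f) w)"

definition avoids :: "'a word \<Rightarrow> 'v formula \<Rightarrow> bool" where
  "avoids w F \<longleftrightarrow> (\<nexists>h. is_occurrence h F w)"

datatype variable = X | Y | Z

end

theory Submission
  imports Defs
begin

text \<open>
  The word is \<open>w = A\<^bsub>t 0\<^esub> B\<^bsub>t 1\<^esub> A\<^bsub>t 2\<^esub> B\<^bsub>t 3\<^esub> \<dots>\<close>, where the three blocks \<open>A\<^sub>i\<close> have length 114, the three
  blocks \<open>B\<^sub>i\<close> have length 125, and \<open>t\<close> is a sequence over \<open>\<int>/3\<close>. In every formula both \<open>y\<close> and \<open>y\<^sup>R\<close>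
  occur, and a factor of \<open>w\<close> whose reversal is a factor has length at most 10, so \<open>|y| \<le> 10\<close>. Both
  fragments are repetitions of the same period \<open>P = |x| + 2|y| + |z|\<close>, with excesses \<open>|x|\<close> and \<open>|z|\<close>;
  hence one of them has excess at least \<open>(P - 20) / 2\<close>. For \<open>P \<ge> 105\<close> this is impossible: long factors
  of \<open>w\<close> determine their position modulo 239 (up to one coincidence at distance 177, excluded
  separately), and a repetition whose period is \<open>239 J\<close> would yield \<open>t(i) = t(i + 2 J)\<close> for \<open>J\<close>
  consecutive \<open>i\<close>. The latter never happens because \<open>t(15 n) = - t(n + 1)\<close> allows a descent when 15
  divides \<open>J\<close>, and otherwise the increments of \<open>t\<close> synchronise modulo 15. The periods below 105 are
  a finite check.
\<close>

subsection \<open>The directing sequence\<close>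

text \<open>Images of the letters under a 15-uniform morphism that commutes with complementation;
  \<open>useq\<close> is its fixed point starting with \<open>False\<close>. In
  \<open>ublock False\<close>, four of the eight even offsets and all seven odd offsets carry
  \<open>True\<close>; \<open>tseq_mult15\<close> rests on these counts.\<close>

definition ublock :: "bool \<Rightarrow> bool list" where
  "ublock b = map (\<lambda>c. b \<noteq> c) [False, True, False, True, True, True, False, True, True, True,
     False, True, True, True, True]"

fun useq :: "nat \<Rightarrow> bool" where
  "useq n = (if n = 0 then False else ublock (useq (n div 15)) ! (n mod 15))"

declare useq.simps [simp del]

fun rot :: "bool \<Rightarrow> nat \<Rightarrow> nat" where
  "rot True 0 = Suc 0"
| "rot True (Suc 0) = Suc (Suc 0)"
| "rot True (Suc (Suc _)) = 0"
| "rot False 0 = Suc (Suc 0)"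
| "rot False (Suc 0) = 0"
| "rot False (Suc (Suc _)) = Suc 0"

text \<open>Since \<open>rot\<close> adds 1 or -1 modulo 3, these are two interleaved walks on Z/3:
  even indices serve the A blocks, odd indices the B blocks.\<close>

fun tseq :: "nat \<Rightarrow> nat" where
  "tseq 0 = 0"
| "tseq (Suc 0) = 0"
| "tseq (Suc (Suc n)) = rot (useq n) (tseq n)"

lemma length_ublock: "length (ublock b) = 15"
  by (simp add: ublock_def)

lemma useq_mult_add:
  assumes "i < 15"
  shows "useq (15 * n + i) = ublock (useq n) ! i"
proof (cases "n = 0 \<and> i = 0")
  case True
  then show ?thesis
    using useq.simps[of 0] by (simp add: ublock_def)
next
  case False
  then show ?thesis
    using useq.simps[of "15 * n + i"] assms by auto
qed

lemma tseq_less: "tseq n < 3"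
proof (induction n rule: tseq.induct)
  case (3 n)
  then show ?case by (cases "(useq n, tseq n)" rule: rot.cases) auto
qed simp_all

lemma useq_block: "map (\<lambda>j. useq (15 * n + j)) [0..<15] = ublock (useq n)"
  by (rule nth_equalityI) (auto simp: useq_mult_add ublock_def simp del: upt_rec_numeral)

definition ublocks :: "nat \<Rightarrow> nat \<Rightarrow> bool list" where
  "ublocks k n = map (\<lambda>j. useq (n + j)) [0..<k]"

lemma concat_ublocks:
  "concat (map ublock (ublocks k n)) = map (\<lambda>j. useq (15 * n + j)) [0..<15 * k]"
proof (induction k)
  case 0
  then show ?case by (simp add: ublocks_def)
next
  case (Suc k)
  have "map (\<lambda>j. useq (15 * n + j)) [0..<15 * Suc k]
    = map (\<lambda>j. useq (15 * n + j)) [0..<15 * k] @ map (\<lambda>j. useq (15 * n + j)) [15 * k..<15 * k + 15]"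
    using upt_add_eq_append[of 0 "15 * k" 15] by (simp add: add.commute del: upt_rec_numeral)
  also have "map (\<lambda>j. useq (15 * n + j)) [15 * k..<15 * k + 15] = map (\<lambda>j. useq (15 * (n + k) + j)) [0..<15]"
    by (rule nth_equalityI) (auto simp: algebra_simps simp del: upt_rec_numeral)
  also have "\<dots> = ublock (useq (n + k))"
    by (rule useq_block)
  finally show ?case
    using Suc by (simp add: ublocks_def del: upt_rec_numeral)
qed

lemma drop_concat_ublocks:
  "drop (i mod 15) (concat (map ublock (ublocks k (i div 15)))) = map (\<lambda>j. useq (i + j)) [0..<15 * k - i mod 15]"
proof (rule nth_equalityI)
  fix j assume "j < length (drop (i mod 15) (concat (map ublock (ublocks k (i div 15)))))"
  then have j: "i mod 15 + j < 15 * k"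
    by (simp add: concat_ublocks)
  have "15 * (i div 15) + (i mod 15 + j) = i + j"
    using mult_div_mod_eq[of 15 i] by linarith
  with j show "drop (i mod 15) (concat (map ublock (ublocks k (i div 15)))) ! j =
      map (\<lambda>j. useq (i + j)) [0..<15 * k - i mod 15] ! j"
    by (simp add: concat_ublocks)
qed (simp add: concat_ublocks)

primrec skip_rot :: "nat \<Rightarrow> bool list \<Rightarrow> nat \<Rightarrow> nat" where
  "skip_rot 0 xs s = s"
| "skip_rot (Suc m) xs s = skip_rot m (tl (tl xs)) (rot (hd xs) s)"

text \<open>The last of the \<open>m\<close> steps reads index \<open>2 * m - 2\<close> of
  \<open>xs\<close>, whence the \<open>+ 1\<close> in the bound.\<close>

lemma tseq_skip_rot:
  assumes "2 * m \<le> length xs + 1" and "\<And>j. j < length xs \<Longrightarrow> xs ! j = useq (i + j)"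
  shows "tseq (i + 2 * m) = skip_rot m xs (tseq i)"
  using assms
proof (induction m arbitrary: i xs)
  case 0
  then show ?case by simp
next
  case (Suc m)
  have hd: "hd xs = useq i"
    using Suc.prems by (cases xs) force+
  have tl: "tl (tl xs) ! j = useq (i + 2 + j)" if "j < length (tl (tl xs))" for j
    using that Suc.prems(2)[of "j + 2"] by (simp add: nth_tl)
  have "tseq (i + 2 * Suc m) = tseq ((i + 2) + 2 * m)"
    by simp
  also have "\<dots> = skip_rot m (tl (tl xs)) (tseq (i + 2))"
    using Suc.prems tl by (intro Suc.IH) auto
  finally show ?case
    by (simp add: hd)
qed

fun neg :: "nat \<Rightarrow> nat" where
  "neg 0 = 0"
| "neg (Suc 0) = Suc (Suc 0)"
| "neg (Suc (Suc _)) = Suc 0"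

lemma less3_cases: "s < 3 \<Longrightarrow> s = 0 \<or> s = Suc 0 \<or> s = Suc (Suc 0)"
  by linarith

text \<open>Because 15 is odd, the two parities swap and both equations need a joint induction. Over
  one block image the increments at even offsets sum to 0 modulo 3, those at odd offsets to minus
  the increment given by \<open>useq n\<close>.\<close>

lemma tseq_mult15: "tseq (15 * n) = neg (tseq (n + 1)) \<and> tseq (15 * n + 1) = neg (tseq n)"
proof (induction n)
  case 0
  then show ?case by simp
next
  case (Suc n)
  have "tseq (15 * n + 2 * 8) = skip_rot 8 (ublock (useq n)) (tseq (15 * n))"
    by (rule tseq_skip_rot) (auto simp: useq_mult_add length_ublock)
  also have "\<dots> = tseq (15 * n)"
    using less3_cases[OF tseq_less[of "15 * n"]]
    by (cases "useq n") (auto simp: ublock_def eval_nat_numeral)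
  finally have E: "tseq (15 * Suc n + 1) = tseq (15 * n)"
    by (simp add: add.commute)
  have "tseq (15 * n + 1 + 2 * 7) = skip_rot 7 (tl (ublock (useq n))) (tseq (15 * n + 1))"
    using useq_mult_add[of "Suc j" n for j]
    by (intro tseq_skip_rot) (auto simp: length_ublock nth_tl)
  also have "\<dots> = rot (\<not> useq n) (neg (tseq n))"
    using less3_cases[OF tseq_less[of n]] Suc
    by (cases "useq n") (auto simp: ublock_def eval_nat_numeral)
  also have "\<dots> = neg (rot (useq n) (tseq n))"
    using less3_cases[OF tseq_less[of n]] by (cases "useq n") auto
  finally have "tseq (15 * Suc n) = neg (tseq (Suc n + 1))"
    by (simp add: add.commute)
  with E Suc show ?case by simp
qed

primrec suffixes :: "nat \<Rightarrow> 'a list \<Rightarrow> 'a list list" where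
  "suffixes 0 xs = []"
| "suffixes (Suc n) xs = xs # suffixes n (tl xs)"

lemma set_suffixes: "set (suffixes n xs) = (\<lambda>k. drop k xs) ` {..<n}"
  by (induction n arbitrary: xs) (simp_all add: lessThan_Suc_eq_insert_0 image_image drop_Suc)

definition bool_lists :: "nat \<Rightarrow> bool list list" where
  "bool_lists n = List.n_lists n [False, True]"

lemma ublocks_in_bool_lists: "ublocks k n \<in> set (bool_lists k)"
  by (auto simp: bool_lists_def set_n_lists ublocks_def)

text \<open>Ten consecutive letters lie within two block images, so all pairs of images are
  compared: different phases never share ten letters.\<close>

lemma useq_sync:
  assumes "\<And>j. j < 10 \<Longrightarrow> useq (i + j) = useq (i' + j)"
  shows "i mod 15 = i' mod 15"
proof -
  have chk: "\<forall>v\<in>set (bool_lists 2). \<forall>v'\<in>set (bool_lists 2). \<forall>k\<in>set [0..<15]. \<forall>k'\<in>set [0..<15].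
    take 10 (drop k (concat (map ublock v))) = take 10 (drop k' (concat (map ublock v'))) \<longrightarrow> k = k'"
    by code_simp
  have w: "take 10 (drop (i mod 15) (concat (map ublock (ublocks 2 (i div 15))))) = map (\<lambda>j. useq (i + j)) [0..<10]" for i
    using mod_less_divisor[of 15 i] by (simp add: drop_concat_ublocks take_map min_def del: upt_rec_numeral)
  have "i mod 15 \<in> set [0..<15]" for i :: nat by simp
  then show ?thesis
    using chk[rule_format, OF ublocks_in_bool_lists[of 2 "i div 15"] ublocks_in_bool_lists[of 2 "i' div 15"],
        of "i mod 15" "i' mod 15"] assms unfolding w by auto
qed

theorem tseq_no_run:
  assumes "m > 0"
  shows "\<exists>j<m. tseq (i + j) \<noteq> tseq (i + j + 2 * m)"
  using assms
proof (induction m arbitrary: i rule: less_induct)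
  case (less m)
  show ?case
  proof (rule ccontr)
    assume "\<not> ?case"
    then have run: "\<And>j. j < m \<Longrightarrow> tseq (i + j) = tseq (i + j + 2 * m)"
      by blast
    \<comment> \<open>Equal values at both ends of a double step force equal increments, as 1 and -1
      differ modulo 3.\<close>
    have urun: "useq (i + j) = useq (i + j + 2 * m)" if "j + 2 < m" for j
    proof -
      have "tseq (i + j + 2) = tseq (i + j + 2 * m + 2)"
        using run[of "j + 2"] that by (simp add: add.commute add.left_commute)
      then have "rot (useq (i + j)) (tseq (i + j)) = rot (useq (i + j + 2 * m)) (tseq (i + j))"
        using run[of j] that by simp
      then show ?thesis
        using less3_cases[OF tseq_less[of "i + j"]]
        by (cases "useq (i + j)"; cases "useq (i + j + 2 * m)") auto
    qed
    consider (desc) "15 dvd m" | (big) "\<not> 15 dvd m" "m \<ge> 12" | (small) "m \<le> 11"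
      by linarith
    then show False
    proof cases
      case desc
      then obtain m' where m: "m = 15 * m'" ..
      \<comment> \<open>\<open>15 * n\<close> is the first multiple of 15 from \<open>i\<close> on.
        The run contains \<open>m'\<close> multiples of 15, which \<open>tseq_mult15\<close> turns
        into a run of length \<open>m'\<close> starting at \<open>n + 1\<close>.\<close>
      define n where "n = (i + 14) div 15"
      have n: "i \<le> 15 * n" "15 * n < i + 15"
        unfolding n_def by linarith+
      have "tseq (n + 1 + j) = tseq (n + 1 + j + 2 * m')" if j: "j < m'" for j
      proof -
        have "tseq (15 * (n + j)) = tseq (15 * (n + j) + 2 * m)"
          using run[of "15 * (n + j) - i"] n j m by (simp add: algebra_simps)
        also have "\<dots> = tseq (15 * (n + j + 2 * m'))"
          by (simp add: m algebra_simps)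
        finally have "neg (tseq (n + j + 1)) = neg (tseq (n + j + 2 * m' + 1))"
          using tseq_mult15 by metis
        then have "tseq (n + j + 1) = tseq (n + j + 2 * m' + 1)"
          using less3_cases[OF tseq_less[of "n + j + 1"]]
            less3_cases[OF tseq_less[of "n + j + 2 * m' + 1"]] by auto
        then show ?thesis
          by (simp only: ac_simps)
      qed
      moreover have "m' < m" "m' > 0"
        using less.prems m by auto
      ultimately show False
        using less.IH[of m' "n + 1"] by blast
    next
      case big
      then have "useq (i + j) = useq ((i + 2 * m) + j)" if "j < 10" for j
        using urun[of j] that by (simp add: ac_simps)
      then have "i mod 15 = (i + 2 * m) mod 15"
        by (rule useq_sync)
      then have "15 dvd 2 * m"
        using mod_eq_dvd_iff_nat[of i "i + 2 * m" 15] by simp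
      \<comment> \<open>8 is the inverse of 2 modulo 15.\<close>
      then have "15 dvd 8 * (2 * m) - 15 * m"
        using dvd_diff_nat[OF dvd_mult[of 15 "2 * m" 8] dvd_triv_left[of 15 m]] by simp
      then have "15 dvd m"
        by simp
      with big show False by simp
    next
      case small
      \<comment> \<open>Whatever images follow each other and whatever the phase, some
        \<open>j < m\<close> starts \<open>m\<close> double steps whose increments do not sum to 0
        modulo 3.\<close>
      have chk: "\<forall>v\<in>set (bool_lists 4). \<forall>ys\<in>set (suffixes 15 (concat (map ublock v))).
        \<forall>m\<in>set [1..<12]. \<exists>zs\<in>set (suffixes m ys). \<forall>s\<in>set [0, 1, 2]. skip_rot m zs s \<noteq> s"
        by code_simp
      define v where "v = ublocks 4 (i div 15)"
      have "m \<in> set [1..<12]"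
        using small less.prems by auto
      moreover have "drop (i mod 15) (concat (map ublock v)) \<in> set (suffixes 15 (concat (map ublock v)))"
        by (auto simp: set_suffixes)
      ultimately obtain zs where "zs \<in> set (suffixes m (drop (i mod 15) (concat (map ublock v))))"
        and ne: "\<forall>s\<in>set [0, 1, 2]. skip_rot m zs s \<noteq> s"
        using chk ublocks_in_bool_lists[of 4 "i div 15"] unfolding v_def by blast
      then obtain j where j: "j < m" and zs: "zs = drop j (map (\<lambda>j. useq (i + j)) [0..<15 * 4 - i mod 15])"
        unfolding set_suffixes v_def drop_concat_ublocks by auto
      have "i mod 15 < 15" by simp
      then have "tseq (i + j + 2 * m) = skip_rot m zs (tseq (i + j))"
        using small j by (intro tseq_skip_rot) (auto simp: zs add.assoc)
      then show False
        using run[OF j] ne less3_cases[OF tseq_less[of "i + j"]] by (auto simp: numeral_2_eq_2)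
    qed
  qed
qed

subsection \<open>The blocks and their factors\<close>

text \<open>The blocks are given by their run lengths. They were found by a computer search.\<close>

fun expand :: "bool \<Rightarrow> nat list \<Rightarrow> bool list" where
  "expand b [] = []"
| "expand b (n # ns) = replicate n b @ expand (\<not> b) ns"

definition ablocks :: "bool list list" where
  "ablocks = map (expand False) [
    [1, 4, 4, 1, 1, 2, 1, 1, 2, 2, 2, 4, 1, 2, 4, 1, 2, 4, 1, 1, 2, 2, 2, 4, 4, 1, 1, 2,
     1, 1, 2, 2, 4, 4, 1, 2, 4, 1, 1, 2, 1, 1, 2, 2, 4, 1, 2, 4, 1, 1, 2, 2, 2, 4, 1],
    [1, 4, 1, 1, 2, 2, 2, 4, 4, 1, 1, 2, 1, 1, 2, 2, 4, 4, 1, 2, 4, 1, 2, 4, 4, 1, 1, 2,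
     1, 1, 2, 2, 2, 4, 1, 2, 4, 1, 1, 2, 1, 1, 2, 2, 4, 1, 2, 4, 1, 1, 2, 2, 2, 4, 1],
    [1, 4, 1, 1, 2, 2, 2, 4, 4, 1, 1, 2, 1, 1, 2, 2, 4, 4, 1, 2, 4, 1, 1, 2, 1, 1, 2, 2,
     4, 1, 2, 4, 4, 1, 1, 2, 1, 1, 2, 2, 2, 4, 1, 2, 4, 1, 2, 4, 1, 1, 2, 2, 2, 4, 1]]"

definition bblocks :: "bool list list" where
  "bblocks = map (expand False) [
    [3, 1, 1, 2, 1, 1, 2, 2, 4, 4, 1, 1, 2, 2, 2, 4, 1, 2, 4, 1, 2, 4, 1, 2, 1, 1, 2, 2,
     4, 1, 2, 4, 1, 1, 2, 2, 2, 4, 4, 1, 1, 2, 1, 1, 2, 2, 2, 4, 1, 2, 1, 1, 2, 2, 4, 4,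
     1, 2, 4, 1, 1],
    [3, 1, 1, 2, 1, 1, 2, 2, 4, 4, 1, 1, 2, 2, 2, 4, 1, 2, 4, 1, 2, 4, 1, 1, 2, 2, 2, 4,
     1, 2, 1, 1, 2, 2, 4, 1, 2, 4, 4, 1, 1, 2, 1, 1, 2, 2, 2, 4, 1, 2, 1, 1, 2, 2, 4, 4,
     1, 2, 4, 1, 1],
    [3, 1, 1, 2, 1, 1, 2, 2, 4, 4, 1, 1, 2, 2, 2, 4, 1, 2, 1, 1, 2, 2, 4, 1, 2, 4, 1, 1,
     2, 2, 2, 4, 4, 1, 1, 2, 1, 1, 2, 2, 2, 4, 1, 2, 4, 1, 2, 4, 1, 2, 1, 1, 2, 2, 4, 4,
     1, 2, 4, 1, 1]]"

text \<open>
  The functions below are evaluated by rewriting. They match on constructors only, with boolean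
  results passed as arguments, because conditionals would make the rewriting traverse their
  branches again at every step.
\<close>

fun initial :: "nat \<Rightarrow> 'a list \<Rightarrow> 'a list" where
  "initial 0 xs = []"
| "initial (Suc n) [] = []"
| "initial (Suc n) (x # xs) = x # initial n xs"

fun final :: "nat \<Rightarrow> 'a list \<Rightarrow> 'a list" where
  "final 0 xs = xs"
| "final (Suc n) [] = []"
| "final (Suc n) (x # xs) = final n xs"

fun drop_len :: "'b list \<Rightarrow> 'a list \<Rightarrow> 'a list" where
  "drop_len [] ys = ys"
| "drop_len (x # xs) [] = []"
| "drop_len (x # xs) (y # ys) = drop_len xs ys"

fun take_len :: "'b list \<Rightarrow> 'a list \<Rightarrow> 'a list" where
  "take_len [] ys = []"
| "take_len (x # xs) [] = []"
| "take_len (x # xs) (y # ys) = y # take_len xs ys"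

fun revapp :: "'a list \<Rightarrow> 'a list \<Rightarrow> 'a list" where
  "revapp [] ys = ys"
| "revapp (x # xs) ys = revapp xs (x # ys)"

fun andb :: "bool \<Rightarrow> bool \<Rightarrow> bool" where
  "andb True b = b"
| "andb False b = False"

fun orb :: "bool \<Rightarrow> bool \<Rightarrow> bool" where
  "orb True b = True"
| "orb False b = b"

fun eqb :: "bool \<Rightarrow> bool \<Rightarrow> bool" where
  "eqb True b = b"
| "eqb False True = False"
| "eqb False False = True"

fun eql :: "bool list \<Rightarrow> bool list \<Rightarrow> bool" where
  "eql [] [] = True"
| "eql [] (y # ys) = False"
| "eql (x # xs) [] = False"
| "eql (True # xs) (True # ys) = eql xs ys"
| "eql (False # xs) (False # ys) = eql xs ys"
| "eql (True # xs) (False # ys) = False"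
| "eql (False # xs) (True # ys) = False"

fun elem :: "bool \<Rightarrow> bool list \<Rightarrow> bool list list \<Rightarrow> bool" where
  "elem True x ys = True"
| "elem False x [] = False"
| "elem False x (y # ys) = elem (eql x y) x ys"

fun insert_new :: "bool \<Rightarrow> bool list \<Rightarrow> bool list list \<Rightarrow> bool list list" where
  "insert_new True x xs = xs"
| "insert_new False x xs = x # xs"

fun dedup :: "bool list list \<Rightarrow> bool list list" where
  "dedup [] = []"
| "dedup (x # xs) = insert_new (elem False x xs) x (dedup xs)"

fun attach :: "nat \<Rightarrow> int \<Rightarrow> bool list \<Rightarrow> bool list list \<Rightarrow> (int \<times> bool list) list" where
  "attach W pos s [] = []"
| "attach W pos s (p # ps) = (pos, initial W (s @ p)) # attach W pos s ps"

fun attach_all :: "nat \<Rightarrow> int \<Rightarrow> bool list list \<Rightarrow> bool list list \<Rightarrow> (int \<times> bool list) list" where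
  "attach_all W pos [] ps = []"
| "attach_all W pos (s # ss) ps = attach W pos s ps @ attach_all W pos ss ps"

fun prepend_all :: "bool list list \<Rightarrow> bool list list \<Rightarrow> bool list list" where
  "prepend_all [] ps = []"
| "prepend_all (d # ds) ps = map (append d) ps @ prepend_all ds ps"

text \<open>\<open>m\<close> is the number of letters reaching beyond the block from
  \<open>ds\<close>.\<close>

fun continuations :: "nat \<Rightarrow> nat \<Rightarrow> bool list list \<Rightarrow> bool list list \<Rightarrow> bool list list" where
  "continuations k 0 cs ds = dedup (map (initial k) ds)"
| "continuations k (Suc m) cs ds = prepend_all ds (dedup (map (initial (Suc m)) cs))"

text \<open>
  All windows of length \<open>W\<close> starting in a block from \<open>cs\<close>, which is followed by a block from \<open>ds\<close> and
  then a block from \<open>cs\<close>, together with the position of their start. Every combination of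
  blocks is allowed, also those that \<open>t\<close> does not produce.
\<close>

fun windows :: "nat \<Rightarrow> nat \<Rightarrow> bool list list \<Rightarrow> bool list list \<Rightarrow> nat \<Rightarrow> int \<Rightarrow> bool list list \<Rightarrow> (int
    \<times> bool list) list" where
  "windows W ld cs ds 0 pos sufs = []"
| "windows W ld cs ds (Suc n) pos sufs =
    attach_all W pos sufs (continuations (W - Suc n) (W - Suc n - ld) cs ds) @
    windows W ld cs ds n (pos + 1) (dedup (map tl sufs))"

definition all_windows :: "nat \<Rightarrow> (int \<times> bool list) list" where
  "all_windows W = windows W 125 ablocks bblocks 114 0 ablocks @ windows W 114 bblocks ablocks 125 114 bblocks"

fun tails :: "bool \<Rightarrow> (int \<times> bool list) list \<Rightarrow> (int \<times> bool list) list" where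
  "tails b [] = []"
| "tails b ((i, []) # its) = tails b its"
| "tails True ((i, True # x) # its) = (i, x) # tails True its"
| "tails False ((i, False # x) # its) = (i, x) # tails False its"
| "tails True ((i, False # x) # its) = tails True its"
| "tails False ((i, True # x) # its) = tails False its"

fun all_pos :: "bool \<Rightarrow> int \<Rightarrow> (int \<times> bool list) list \<Rightarrow> bool" where
  "all_pos False i its = False"
| "all_pos True i [] = True"
| "all_pos True i ((j, x) # its) = all_pos (i = j) i its"

fun same_pos :: "(int \<times> bool list) list \<Rightarrow> bool" where
  "same_pos [] = True"
| "same_pos ((i, x) # its) = all_pos True i its"

datatype trie = Leaf "bool list list" | Node trie trie

text \<open>Branching stops where all remaining words belong to one position; these are then
  compared as a whole.\<close>

fun mk_trie :: "nat \<Rightarrow> (int \<times> bool list) list \<Rightarrow> trie"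
  and mk_node :: "bool \<Rightarrow> nat \<Rightarrow> (int \<times> bool list) list \<Rightarrow> trie" where
  "mk_trie 0 its = Leaf (map snd its)"
| "mk_trie (Suc k) its = mk_node (same_pos its) k its"
| "mk_node True k its = Leaf (map snd its)"
| "mk_node False k its = Node (mk_trie k (tails False its)) (mk_trie k (tails True its))"

fun compat :: "bool list \<Rightarrow> bool list \<Rightarrow> bool" where
  "compat [] ys = True"
| "compat (x # xs) [] = True"
| "compat (True # xs) (True # ys) = compat xs ys"
| "compat (False # xs) (False # ys) = compat xs ys"
| "compat (True # xs) (False # ys) = False"
| "compat (False # xs) (True # ys) = False"

fun exists_compat :: "bool \<Rightarrow> bool list \<Rightarrow> bool list list \<Rightarrow> bool" where
  "exists_compat True s xs = True"
| "exists_compat False s [] = False"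
| "exists_compat False s (x # xs) = exists_compat (compat s x) s xs"

text \<open>A necessary test for factors: a short word passes as a prefix of a stored one, and only
  an initial part of a long word is examined.\<close>

fun in_trie :: "trie \<Rightarrow> bool list \<Rightarrow> bool" where
  "in_trie (Leaf xs) s = exists_compat False s xs"
| "in_trie (Node f t) [] = True"
| "in_trie (Node f t) (True # s) = in_trie t s"
| "in_trie (Node f t) (False # s) = in_trie f s"

text \<open>
  What is required of two positions \<open>i\<close> and \<open>j\<close> modulo 239 that share a factor of length \<open>d\<close>: the
  period \<open>P \<ge> 105\<close> leading from one to the other satisfies \<open>2 d + 20 < P\<close>, except for \<open>P = 177\<close>. The
  last clause lists all coincidences of length at least 73.
\<close>

definition pos_ok :: "int \<Rightarrow> int \<Rightarrow> int \<Rightarrow> bool" where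
  "pos_ok d i j \<longleftrightarrow> i = j \<or>
     (105 \<le> \<bar>i - j\<bar> \<longrightarrow> 2 * d + 20 < \<bar>i - j\<bar> \<or> \<bar>i - j\<bar> = 177) \<and>
     (\<bar>i - j\<bar> \<le> 134 \<longrightarrow> 2 * d + 20 < 239 - \<bar>i - j\<bar>) \<and>
     (73 \<le> d \<longrightarrow> \<bar>i - j\<bar> = 177 \<and> 53 \<le> min i j \<and> min i j \<le> 61 \<or>
                \<bar>i - j\<bar> = 62 \<and> 62 \<le> max i j \<and> max i j \<le> 64 \<or> \<bar>i - j\<bar> = 205)"

text \<open>The flag skips depths below 43: \<open>P \<ge> 105\<close> and
  \<open>2 * d + 20 \<ge> P\<close> imply \<open>d \<ge> 43\<close>.\<close>

fun pairs_ok :: "bool \<Rightarrow> int \<Rightarrow> (int \<times> bool list) list \<Rightarrow> bool" where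
  "pairs_ok True d its = True"
| "pairs_ok False d its = (\<forall>i\<in>set (remdups (map fst its)). \<forall>j\<in>set (remdups (map fst its)). pos_ok d i j)"

text \<open>Walks down the tree of common prefixes; the words in \<open>its\<close> have already
  shared \<open>d\<close> letters, and \<open>k\<close> bounds the further depth.\<close>

fun separated :: "nat \<Rightarrow> int \<Rightarrow> (int \<times> bool list) list \<Rightarrow> bool"
  and separated_node :: "bool \<Rightarrow> nat \<Rightarrow> int \<Rightarrow> (int \<times> bool list) list \<Rightarrow> bool" where
  "separated 0 d its = same_pos its"
| "separated (Suc k) d its = separated_node (same_pos its) k d its"
| "separated_node True k d its = True"
| "separated_node False k d its = andb (pairs_ok (d < 43) d its)
    (andb (separated k (d + 1) (tails False its)) (separated k (d + 1) (tails True its)))"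

subsection \<open>The search for short periods\<close>

text \<open>
  Up to exchanging \<open>x\<close> and \<open>z\<close>, an occurrence consists of two factors \<open>L a S y L\<close> and \<open>S p L q S\<close> with
  \<open>|S| \<le> |L|\<close>, where each of \<open>y, p, q\<close> is \<open>a\<close> or \<open>r = a\<^sup>R\<close>. For given \<open>L\<close>, \<open>a\<close>, \<open>S\<close>, the search lists the
  second factors \<open>S p L q S\<close> as queries \<open>(S, L, S', L', p, q)\<close>, where \<open>S'\<close> and \<open>L'\<close> are short suffixes of
  \<open>S\<close> and \<open>L\<close> used for a quick first test. The list \<open>mr\<close> is the reversal of \<open>L a S y\<close>, and the query of
  six empty words, which stands for a factor of every word, signals that a window was too short.
\<close>

fun partners :: "bool \<Rightarrow> bool list \<Rightarrow> bool list \<Rightarrow> bool \<Rightarrow> (bool list \<times> bool list) list" where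
  "partners True a r rv = [(a, a)]"
| "partners False a r True = [(a, r), (r, a), (r, r), (a, a)]"
| "partners False a r False = [(a, r), (r, a), (r, r)]"

type_synonym query = "bool list \<times> bool list \<times> bool list \<times> bool list \<times> bool list \<times> bool list"

fun fragments :: "bool list \<Rightarrow> bool list \<Rightarrow> bool list \<Rightarrow> bool list \<Rightarrow>
    (bool list \<times> bool list) list \<Rightarrow> query list" where
  "fragments S L S' L' [] = []"
| "fragments S L S' L' ((p, q) # ps) = (S, L, S', L', p, q) # fragments S L S' L' ps"

fun end12 :: "bool list \<Rightarrow> bool list" where
  "end12 xs = revapp (initial 12 (revapp xs [])) []"

fun fragments_if_short :: "bool list \<Rightarrow> bool list \<Rightarrow> bool list \<Rightarrow> bool \<Rightarrow> bool list \<Rightarrow> query list" where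
  "fragments_if_short [] L r rv S = fragments S L (end12 S) (end12 L)
    (partners (eql (revapp r []) r) (revapp r []) r rv)"
| "fragments_if_short (x # xs) L r rv S = []"

fun candidate :: "bool list \<Rightarrow> bool list \<Rightarrow> bool list \<Rightarrow> bool \<Rightarrow> bool list \<Rightarrow> query list" where
  "candidate [] L r rv vs = []"
| "candidate (z # zs) L r rv vs =
    fragments_if_short (drop_len L (z # zs)) L r rv (take_len (z # zs) vs)"

text \<open>Removing from \<open>mr\<close> as many letters as \<open>a\<close>, \<open>y\<close>
  and \<open>L\<close> have leaves a list whose length is that of \<open>S\<close>; \<open>S\<close>
  itself is read from the window.\<close>

fun candidates :: "bool list \<Rightarrow> bool list \<Rightarrow> bool list \<Rightarrow> (bool list \<times> bool) list \<Rightarrow> query list" where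
  "candidates L vs mr [] = []"
| "candidates L vs mr ((r, rv) # cs) =
    candidate (drop_len L (drop_len r (drop_len r mr))) L r rv (drop_len r vs) @ candidates L vs mr cs"

fun select :: "bool \<Rightarrow> 'a \<Rightarrow> 'a list" where
  "select True x = [x]"
| "select False x = []"

text \<open>Reads \<open>a\<close> forwards from the window and \<open>y\<close> backwards from
  \<open>mr\<close>. The list \<open>r\<close> collects the reversal of \<open>a\<close>, and
  \<open>rv\<close> records whether \<open>y\<close> equals it. The last list is a counter: two
  letters go per letter of \<open>a\<close>, and one must remain for \<open>S\<close>.\<close>

fun ywords :: "bool \<Rightarrow> bool list \<Rightarrow> bool list \<Rightarrow> bool list \<Rightarrow> bool list \<Rightarrow> bool list \<Rightarrow>
    bool list \<Rightarrow> (bool list \<times> bool) list" where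
  "ywords rv y r vs0 (c # vs) (d # mr) (z # z' # z'' # zs) =
     select (orb (andb rv (eqb c d)) (compat (d # y) vs0)) (c # r, andb rv (eqb c d)) @
     ywords (andb rv (eqb c d)) (d # y) (c # r) vs0 vs mr (z'' # zs)"
| "ywords rv y r vs0 [] mr zs = []"
| "ywords rv y r vs0 (c # vs) [] zs = []"
| "ywords rv y r vs0 (c # vs) (d # mr) [] = []"
| "ywords rv y r vs0 (c # vs) (d # mr) [z] = []"
| "ywords rv y r vs0 (c # vs) (d # mr) [z, z'] = []"

text \<open>\<open>L\<close> grows letter by letter while the window agrees with its shift by the
  period, and every length yields its own candidates.\<close>

fun extend :: "bool \<Rightarrow> bool list \<Rightarrow> bool list \<Rightarrow> bool list \<Rightarrow> bool list \<Rightarrow> bool list \<Rightarrow> query list" where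
  "extend False rl vs us mr10 mr = []"
| "extend True rl vs [] mr10 mr = [([], [], [], [], [], [])]"
| "extend True rl [] (c # us) mr10 mr = [([], [], [], [], [], [])]"
| "extend True rl (x # vs) (c # us) mr10 mr =
    candidates (revapp rl []) (x # vs) mr
      (ywords True [] [] (initial 10 (x # vs)) (initial 10 (x # vs)) mr10 (drop_len rl mr)) @
    extend (eqb x c) (x # rl) vs us mr10 mr"

fun agree :: "nat \<Rightarrow> bool list \<Rightarrow> bool list \<Rightarrow> bool" where
  "agree 0 xs ys = True"
| "agree (Suc n) [] ys = True"
| "agree (Suc n) (x # xs) [] = True"
| "agree (Suc n) (True # xs) (True # ys) = agree n xs ys"
| "agree (Suc n) (False # xs) (False # ys) = agree n xs ys"
| "agree (Suc n) (True # xs) (False # ys) = False"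
| "agree (Suc n) (False # xs) (True # ys) = False"

fun hit :: "bool \<Rightarrow> nat \<Rightarrow> bool list \<Rightarrow> bool list \<Rightarrow> bool list \<Rightarrow> query list" where
  "hit False n v u mr = []"
| "hit True n v u mr = extend True (revapp (initial n v) []) (final n v) (final n u) (initial 10 mr) mr"

text \<open>\<open>ns\<close> lists the least excesses for consecutive periods, and \<open>u\<close>
  is the window shifted by the current one.\<close>

fun scan :: "bool list \<Rightarrow> nat list \<Rightarrow> bool list \<Rightarrow> bool list \<Rightarrow> query list" where
  "scan v [] u mr = []"
| "scan v (n # ns) [] mr = [([], [], [], [], [], [])]"
| "scan v (n # ns) (c # u) mr = hit (agree n v (c # u)) n v (c # u) mr @ scan v ns u (c # mr)"

fun keep :: "bool \<Rightarrow> 'a \<Rightarrow> 'a list \<Rightarrow> 'a list" where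
  "keep True x xs = x # xs"
| "keep False x xs = xs"

fun all_in_trie :: "bool \<Rightarrow> trie \<Rightarrow> bool list list \<Rightarrow> bool" where
  "all_in_trie False T ts = False"
| "all_in_trie True T [] = True"
| "all_in_trie True T (t # ts) = all_in_trie (in_trie T t) T ts"

text \<open>A cheap test of pieces of the second fragment in a shallow trie; survivors go to
  \<open>excluded\<close>, which tests the whole fragment in a deeper one.\<close>

fun prefilter :: "trie \<Rightarrow> query list \<Rightarrow> query list" where
  "prefilter T [] = []"
| "prefilter T ((S, L, S', L', p, q) # qs) =
    keep (all_in_trie True T [p @ L, L' @ q @ S, S' @ p @ L]) (S, L, S', L', p, q) (prefilter T qs)"

fun all_suffixes :: "bool \<Rightarrow> trie \<Rightarrow> bool list \<Rightarrow> bool" where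
  "all_suffixes False T xs = False"
| "all_suffixes True T [] = True"
| "all_suffixes True T (x # xs) = all_suffixes (in_trie T (x # xs)) T xs"

fun excluded :: "bool \<Rightarrow> trie \<Rightarrow> query list \<Rightarrow> bool" where
  "excluded True T qs = False"
| "excluded False T [] = True"
| "excluded False T ((S, L, S', L', p, q) # qs) =
    excluded (all_suffixes (in_trie T (p @ L @ q @ S)) T (S @ p @ L @ q @ S)) T qs"

fun survivors :: "trie \<Rightarrow> nat list \<Rightarrow> nat \<Rightarrow> (int \<times> bool list) list \<Rightarrow> query list" where
  "survivors T ns P [] = []"
| "survivors T ns P ((i, v) # its) =
    prefilter T (scan v ns (final P v) (revapp (initial P v) [])) @ survivors T ns P its"

fun check_windows :: "nat list \<Rightarrow> nat \<Rightarrow> trie \<Rightarrow> trie \<Rightarrow>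
    nat \<Rightarrow> nat \<Rightarrow> bool list list \<Rightarrow> bool list list \<Rightarrow> nat \<Rightarrow> int \<Rightarrow> bool list list \<Rightarrow> bool" where
  "check_windows ns P T1 T2 W ld cs ds 0 pos sufs = True"
| "check_windows ns P T1 T2 W ld cs ds (Suc n) pos sufs =
    andb
      (excluded False T2 (survivors T1 ns P
        (attach_all W pos sufs (continuations (W - Suc n) (W - Suc n - ld) cs ds))))
      (check_windows ns P T1 T2 W ld cs ds n (pos + 1) (dedup (map tl sufs)))"

text \<open>The least excess \<open>l > 0\<close> with \<open>2 l + 20 \<ge> P\<close>, for \<open>P = 4, \<dots>, 104\<close>.\<close>

definition needs :: "nat list" where
  "needs = replicate 19 1 @ concat (map (\<lambda>n. [n, n]) [2..<43])"

fun check_range :: "nat \<Rightarrow> nat \<Rightarrow> nat \<Rightarrow> trie \<Rightarrow> trie \<Rightarrow> bool" where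
  "check_range W P k T1 T2 = andb
    (check_windows (initial k (final (P - 4) needs)) P T1 T2 W 125 ablocks bblocks 114 0 ablocks)
    (check_windows (initial k (final (P - 4) needs)) P T1 T2 W 114 bblocks ablocks 125 114 bblocks)"

text \<open>The periods 4 to 104 in five ranges with growing window lengths. A window length that is
  too small makes the check fail, because the query of empty words is never excluded.\<close>

fun check_ranges :: "trie \<Rightarrow> trie \<Rightarrow> bool" where
  "check_ranges T1 T2 =
    andb (check_range 50 4 26 T1 T2) (andb (check_range 70 30 11 T1 T2)
      (andb (check_range 90 41 12 T1 T2) (andb (check_range 116 53 14 T1 T2)
        (check_range 153 67 38 T1 T2))))"

subsection \<open>Correctness of the search\<close>

lemma initial_eq: "initial n xs = take n xs"
  by (induction n xs rule: initial.induct) auto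

lemma final_eq: "final n xs = drop n xs"
  by (induction n xs rule: final.induct) auto

lemma drop_len_eq: "drop_len xs ys = drop (length xs) ys"
  by (induction xs ys rule: drop_len.induct) auto

lemma take_len_eq: "take_len xs ys = take (length xs) ys"
  by (induction xs ys rule: take_len.induct) auto

lemma revapp_eq: "revapp xs ys = rev xs @ ys"
  by (induction xs ys rule: revapp.induct) auto

lemma andb_eq: "andb a b \<longleftrightarrow> a \<and> b"
  by (cases a) auto

lemma orb_eq: "orb a b \<longleftrightarrow> a \<or> b"
  by (cases a) auto

lemma eqb_eq: "eqb a b \<longleftrightarrow> a = b"
  by (cases a; cases b) auto

lemma eql_eq: "eql xs ys \<longleftrightarrow> xs = ys"
  by (induction xs ys rule: eql.induct) auto

lemma elem_eq: "elem b x ys \<longleftrightarrow> b \<or> x \<in> set ys"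
  by (induction b x ys rule: elem.induct) (auto simp: eql_eq)

lemma set_dedup: "set (dedup xs) = set xs"
proof (induction xs)
  case (Cons x xs)
  then show ?case
    by (cases "elem False x xs") (auto simp: elem_eq)
qed simp

lemma set_attach: "set (attach W pos s ps) = (\<lambda>p. (pos, take W (s @ p))) ` set ps"
  by (induction ps) (auto simp: initial_eq)

lemma set_attach_all:
  "set (attach_all W pos ss ps) = (\<Union>s\<in>set ss. (\<lambda>p. (pos, take W (s @ p))) ` set ps)"
  by (induction ss) (auto simp: set_attach)

lemma set_prepend_all: "set (prepend_all ds ps) = (\<Union>d\<in>set ds. append d ` set ps)"
  by (induction ds) auto

lemma continuations_sound:
  assumes "d \<in> set ds" "c \<in> set cs" "length d = ld"
  shows "take k (d @ c) \<in> set (continuations k (k - ld) cs ds)"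
proof (cases "k - ld")
  case 0
  then show ?thesis using assms by (auto simp: set_dedup initial_eq)
next
  case (Suc m)
  then have "take k (d @ c) = d @ take (Suc m) c"
    using assms(3) by simp
  then show ?thesis using assms Suc by (auto simp: set_prepend_all set_dedup initial_eq simp del: take_append)
qed

lemma windows_sound:
  assumes "s \<in> set sufs" "length s = n" "r < n" "d \<in> set ds" "length d = ld" "c \<in> set cs"
  shows "(pos + int r, take W (drop r s @ d @ c)) \<in> set (windows W ld cs ds n pos sufs)"
  using assms(1-3)
proof (induction n arbitrary: s sufs r pos)
  case 0
  then show ?case by simp
next
  case (Suc n)
  show ?case
  proof (cases r)
    case 0
    have "take W (s @ t) = take W (s @ take (W - Suc n) t)" for t
      using Suc.prems(2) by simp
    from this[of "d @ c"] show ?thesis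
      using 0 Suc.prems(1) continuations_sound[OF assms(4,6,5), of "W - Suc n"]
      by (auto simp: set_attach_all simp del: take_append append_assoc continuations.simps)
  next
    case (Suc r')
    have "(pos + 1 + int r', take W (drop r' (tl s) @ d @ c)) \<in>
       set (windows W ld cs ds n (pos + 1) (dedup (map tl sufs)))"
      using Suc.prems Suc by (intro Suc.IH) (auto simp: set_dedup)
    then show ?thesis
      using Suc by (simp add: drop_Suc add.assoc)
  qed
qed

lemma set_tails: "set (tails b its) = {(i, x). (i, b # x) \<in> set its}"
  by (induction b its rule: tails.induct) auto

lemma all_pos_iff: "all_pos b i its \<longleftrightarrow> b \<and> (\<forall>(j, x)\<in>set its. j = i)"
  by (induction b i its rule: all_pos.induct) auto

lemma same_posD: "same_pos its \<Longrightarrow> (i, x) \<in> set its \<Longrightarrow> (j, y) \<in> set its \<Longrightarrow> i = j"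
proof (cases its)
  case (Cons p its')
  assume "same_pos its" "(i, x) \<in> set its" "(j, y) \<in> set its"
  with Cons have "i = fst p" "j = fst p"
    by (cases p; fastforce simp: all_pos_iff)+
  then show ?thesis by simp
qed simp

lemma compat_iff: "compat xs ys \<longleftrightarrow> take (length ys) xs = take (length xs) ys"
  by (induction xs ys rule: compat.induct) auto

lemma exists_compat_iff: "exists_compat b s xs \<longleftrightarrow> b \<or> (\<exists>x\<in>set xs. compat s x)"
  by (induction b s xs rule: exists_compat.induct) auto

text \<open>Only this direction matters, since tries serve to refute. The bound on \<open>k\<close>
  keeps \<open>tails\<close> from losing a word that has run out of letters.\<close>

lemma in_mk_trie:
  assumes "(i, x) \<in> set its" "compat s x" "k \<le> length x"
  shows "in_trie (mk_trie k its) s"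
  using assms
proof (induction k arbitrary: its x s)
  case 0
  then show ?case by (force simp: exists_compat_iff)
next
  case (Suc k)
  show ?case
  proof (cases "same_pos its")
    case True
    then show ?thesis using Suc.prems by (force simp: exists_compat_iff)
  next
    case False
    obtain b y where x: "x = b # y"
      using Suc.prems(3) by (cases x) auto
    have y: "(i, y) \<in> set (tails b its)"
      using Suc.prems(1) by (simp add: set_tails x)
    show ?thesis
    proof (cases s)
      case Nil
      then show ?thesis using False by simp
    next
      case (Cons c s')
      have "c = b" "compat s' y"
        using Suc.prems(2) x Cons by (auto simp: compat_iff)
      then show ?thesis
        using Suc.IH[OF y, of s'] Suc.prems(3) x Cons False by (cases b) auto
    qed
  qed
qed

text \<open>Along the common prefix both words stay in the same subtree, which therefore never
  satisfies \<open>same_pos\<close>.\<close>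

lemma separated_sound:
  assumes "separated k d its" "(i, x) \<in> set its" "(j, y) \<in> set its" "i \<noteq> j"
    "take e x = take e y" "e \<le> length x" "e \<le> length y" "d + int e \<ge> 43"
  shows "pos_ok (d + int e) i j \<and> e < k"
  using assms
proof (induction k arbitrary: d its x y e)
  case 0
  then show ?case using same_posD by fastforce
next
  case (Suc k)
  have ns: "\<not> same_pos its"
    using same_posD Suc.prems by blast
  show ?case
  proof (cases e)
    case 0
    then have "pos_ok d i j"
      using Suc.prems(1,8) ns Suc.prems(2,3) by (force simp: andb_eq)
    then show ?thesis by (simp add: 0)
  next
    case (Suc e')
    obtain b x' where x: "x = b # x'"
      using Suc.prems(6) Suc by (cases x) auto
    obtain y' where y: "y = b # y'"
      using Suc.prems(5,7) Suc x by (cases y) auto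
    have mem: "(i, x') \<in> set (tails b its)" "(j, y') \<in> set (tails b its)"
      using Suc.prems(2,3) by (auto simp: set_tails x y)
    have "separated k (d + 1) (tails b its)"
      using Suc.prems(1) ns by (cases b) (auto simp: andb_eq)
    then have "pos_ok (d + 1 + int e') i j \<and> e' < k"
      using mem Suc.prems(4-8) x y Suc by (intro Suc.IH[of "d + 1" "tails b its" x' y' e']) auto
    then show ?thesis by (simp add: Suc add.assoc)
  qed
qed

lemma set_partners:
  assumes "(p, q) \<in> {(a, r), (r, a), (r, r)} \<or> rv \<and> (p, q) = (a, a)"
  shows "(p, q) \<in> set (partners (a = r) a r rv)"
  using assms by (cases "a = r"; cases rv) auto

definition query :: "bool list \<Rightarrow> bool list \<Rightarrow> bool list \<times> bool list \<Rightarrow> query" where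
  "query S L = (\<lambda>(p, q). (S, L, end12 S, end12 L, p, q))"

lemma set_fragments: "set (fragments S L (end12 S) (end12 L) ps) = query S L ` set ps"
  by (induction ps) (auto simp: query_def simp del: end12.simps)

lemma end12_suffix: "\<exists>ys. xs = ys @ end12 xs"
proof -
  have "end12 xs = drop (length xs - 12) xs"
    by (simp add: revapp_eq initial_eq take_rev)
  then show ?thesis
    by (metis append_take_drop_id)
qed

lemma candidates_sound:
  assumes "(r, rv) \<in> set cs"
    and "length S + length L + 2 * length r = length mr" "S \<noteq> []" "length S \<le> length L"
    and "vs = rev r @ S @ ext"
    and "(p, q) \<in> {(rev r, r), (r, rev r), (r, r)} \<or> rv \<and> (p, q) = (rev r, rev r)"
  shows "query S L (p, q) \<in> set (candidates L vs mr cs)"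
  using assms(1)
proof (induction cs)
  case Nil
  then show ?case by simp
next
  case (Cons c cs)
  show ?case
  proof (cases "c = (r, rv)")
    case False
    then show ?thesis using Cons by (cases c) auto
  next
    case True
    define zs where "zs = drop (length L) (drop (length r) (drop (length r) mr))"
    have len: "length zs = length S"
      using assms(2) by (simp add: zs_def)
    then obtain z zs' where zs: "zs = z # zs'"
      using assms(3) by (cases zs) auto
    have "take (length zs) (drop (length r) vs) = S"
      using assms(5) len by simp
    moreover have "drop (length L) zs = []"
      using len assms(4) by simp
    ultimately have "set (candidate zs L r rv (drop (length r) vs)) =
        query S L ` set (partners (rev r = r) (rev r) r rv)"
      using zs by (simp add: drop_len_eq take_len_eq revapp_eq eql_eq set_fragments del: end12.simps)
    moreover have "(p, q) \<in> set (partners (rev r = r) (rev r) r rv)"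
      using assms(6) by (intro set_partners) auto
    ultimately show ?thesis
      using True by (force simp: drop_len_eq zs_def)
  qed
qed

lemma ywords_sound:
  assumes "0 < b" "b \<le> length vs" "b \<le> length mr" "2 * b < length zs"
    and "rv \<and> take b vs = take b mr \<or> compat (rev (take b mr) @ y) vs0"
  shows "(rev (take b vs) @ r, rv \<and> take b vs = take b mr) \<in> set (ywords rv y r vs0 vs mr zs)"
  using assms
proof (induction b arbitrary: vs mr rv y r zs)
  case 0
  then show ?case by simp
next
  case (Suc b)
  obtain c vs' d mr' where cd: "vs = c # vs'" "mr = d # mr'"
    using Suc.prems by (cases vs; cases mr) auto
  obtain z z' z'' zs' where zs: "zs = z # z' # z'' # zs'"
    using Suc.prems(4) by (auto simp: less_Suc_eq_le Suc_le_length_iff dest!: Suc_leI)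
  show ?case
  proof (cases "b = 0")
    case True
    then show ?thesis
      using Suc.prems(5) cd zs by (auto simp: andb_eq orb_eq eqb_eq)
  next
    case False
    have "(rev (take b vs') @ (c # r), (rv \<and> c = d) \<and> take b vs' = take b mr') \<in>
        set (ywords (rv \<and> c = d) (d # y) (c # r) vs0 vs' mr' (z'' # zs'))"
      using Suc.prems False cd zs by (intro Suc.IH) auto
    then show ?thesis
      using cd zs by (simp add: andb_eq eqb_eq conj_assoc)
  qed
qed

text \<open>\<open>k\<close> counts the letters by which \<open>L\<close> grows beyond
  \<open>rl\<close>; reaching the end of either list yields the query of empty words.\<close>

lemma extend_sound:
  assumes "take k vs = take k us" "k \<le> length vs" "k \<le> length us"
  shows "if k = length vs \<or> k = length us then ([], [], [], [], [], []) \<in> set (extend True rl vs us mr10 mr)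
    else set (candidates (rev rl @ take k vs) (drop k vs) mr
        (ywords True [] [] (take 10 (drop k vs)) (take 10 (drop k vs)) mr10 (drop (length rl + k) mr)))
      \<subseteq> set (extend True rl vs us mr10 mr)"
  using assms
proof (induction k arbitrary: rl vs us)
  case 0
  then show ?case
    by (cases vs; cases us) (auto simp: revapp_eq initial_eq drop_len_eq)
next
  case (Suc k)
  obtain x vs' us' where xs: "vs = x # vs'" "us = x # us'"
    using Suc.prems by (cases vs; cases us) auto
  have "if k = length vs' \<or> k = length us' then ([], [], [], [], [], []) \<in> set (extend True (x # rl) vs' us' mr10 mr)
    else set (candidates (rev (x # rl) @ take k vs') (drop k vs') mr
        (ywords True [] [] (take 10 (drop k vs')) (take 10 (drop k vs')) mr10
          (drop (length (x # rl) + k) mr)))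
      \<subseteq> set (extend True (x # rl) vs' us' mr10 mr)"
    using Suc.prems xs by (intro Suc.IH) auto
  then show ?case
    using xs by (auto simp: eqb_eq)
qed

lemma agree_if: "(\<And>j. j < n \<Longrightarrow> j < length xs \<Longrightarrow> j < length ys \<Longrightarrow> xs ! j = ys ! j) \<Longrightarrow> agree n xs ys"
  by (induction n xs ys rule: agree.induct) (force simp: nth_Cons)+

lemma scan_hit:
  assumes "j < length ns" "j < length u"
  shows "set (hit (agree (ns ! j) v (drop j u)) (ns ! j) v (drop j u) (rev (take j u) @ mr)) \<subseteq> set (scan v ns u mr)"
  using assms
proof (induction j arbitrary: ns u mr)
  case 0
  then show ?case by (cases ns; cases u) auto
next
  case (Suc j)
  then obtain n ns' c u' where "ns = n # ns'" "u = c # u'"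
    by (cases ns; cases u) auto
  then show ?case
    using Suc.IH[of ns' u' "c # mr"] Suc.prems by auto
qed

lemma scan_exhausted: "length u < length ns \<Longrightarrow> ([], [], [], [], [], []) \<in> set (scan v ns u mr)"
  by (induction v ns u mr rule: scan.induct) auto

lemma all_suffixes_if: "(\<And>n. in_trie T (drop n xs)) \<Longrightarrow> all_suffixes True T xs"
proof (induction xs)
  case (Cons x xs)
  then show ?case
    using Cons.prems[of 0] Cons.prems[of "Suc n" for n] by simp
qed simp

lemma all_in_trie_iff: "all_in_trie b T ts \<longleftrightarrow> b \<and> (\<forall>t\<in>set ts. in_trie T t)"
  by (induction b T ts rule: all_in_trie.induct) auto

lemma set_prefilter:
  "set (prefilter T qs) = {(S, L, S', L', p, q) \<in> set qs.
     in_trie T (p @ L) \<and> in_trie T (L' @ q @ S) \<and> in_trie T (S' @ p @ L)}"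
proof (induction qs)
  case (Cons q qs)
  have "set (keep b x xs) = (if b then insert x (set xs) else set xs)" for b xs and x :: query
    by (cases b) auto
  with Cons show ?case
    by (cases q) (auto simp: all_in_trie_iff simp del: all_in_trie.simps)
qed simp

lemma excluded_iff:
  "excluded b T qs \<longleftrightarrow> \<not> b \<and> (\<forall>(S, L, S', L', p, q)\<in>set qs.
     \<not> all_suffixes (in_trie T (p @ L @ q @ S)) T (S @ p @ L @ q @ S))"
  by (induction b T qs rule: excluded.induct) auto

lemma set_survivors:
  "set (survivors T ns P its) =
     (\<Union>(i, v)\<in>set its. set (prefilter T (scan v ns (drop P v) (rev (take P v)))))"
  by (induction T ns P its rule: survivors.induct) (auto simp: initial_eq final_eq revapp_eq)

subsection \<open>The word\<close>

lemma length_blocks: "length ablocks = 3" "length bblocks = 3"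
    "x \<in> set ablocks \<Longrightarrow> length x = 114" "x \<in> set bblocks \<Longrightarrow> length x = 125"
proof -
  have "length ablocks = 3 \<and> length bblocks = 3 \<and> (\<forall>x\<in>set ablocks. length x = 114) \<and>
      (\<forall>x\<in>set bblocks. length x = 125)"
    by code_simp
  then show "length ablocks = 3" "length bblocks = 3"
    "x \<in> set ablocks \<Longrightarrow> length x = 114" "x \<in> set bblocks \<Longrightarrow> length x = 125"
    by blast+
qed

definition block :: "nat \<Rightarrow> bool list" where
  "block k = (if even k then ablocks else bblocks) ! tseq k"

definition block_pos :: "nat \<Rightarrow> nat" where
  "block_pos k = 239 * (k div 2) + (if even k then 0 else 114)"

definition wseq :: "nat \<Rightarrow> bool" where
  "wseq n = (block (2 * (n div 239)) @ block (2 * (n div 239) + 1)) ! (n mod 239)"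

definition win :: "nat \<Rightarrow> nat \<Rightarrow> bool list" where
  "win i n = map (\<lambda>j. wseq (i + j)) [0..<n]"

lemma block_in: "block k \<in> set (if even k then ablocks else bblocks)"
  using tseq_less[of k] length_blocks(1,2) by (auto simp: block_def)

lemma length_block: "length (block k) = (if even k then 114 else 125)"
  using block_in[of k] length_blocks(3,4) by (auto split: if_splits)

lemma block_pos_Suc: "block_pos (Suc k) = block_pos k + length (block k)"
  by (auto simp: block_pos_def length_block elim!: evenE oddE)

lemma wseq_block: "j < length (block k) \<Longrightarrow> wseq (block_pos k + j) = block k ! j"
proof -
  assume j: "j < length (block k)"
  define b where "b = k div 2"
  show ?thesis
  proof (cases "even k")
    case True
    then have "k = 2 * b" "block_pos k + j = 239 * b + j" "j < 114"
      using j by (auto simp: b_def block_pos_def length_block)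
    then show ?thesis
      by (simp add: wseq_def length_block nth_append)
  next
    case False
    then have k: "k = 2 * b + 1" and pos: "block_pos k + j = 239 * b + (114 + j)" and "j < 125"
      using j by (auto simp: b_def block_pos_def length_block)
    have "(239 * b + (114 + j)) div 239 = b" "(239 * b + (114 + j)) mod 239 = 114 + j"
      using \<open>j < 125\<close> by simp_all
    then show ?thesis
      unfolding wseq_def pos by (simp add: k length_block nth_append)
  qed
qed

lemma length_win [simp]: "length (win i n) = n"
  by (simp add: win_def)

lemma nth_win [simp]: "j < n \<Longrightarrow> win i n ! j = wseq (i + j)"
  by (simp add: win_def)

lemma take_win: "take m (win i n) = win i (min m n)"
  by (rule nth_equalityI) auto

lemma drop_win: "drop m (win i n) = win (i + m) (n - m)"
  by (rule nth_equalityI) (auto simp: add.assoc)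

lemma win_block: "win (block_pos k) (length (block k)) = block k"
  by (rule nth_equalityI) (auto simp: wseq_block)

lemma win_append: "win i (m + n) = win i m @ win (i + m) n"
  by (rule nth_equalityI) (auto simp: nth_append)

lemma win_blocks:
  "win (block_pos k) (length (block k @ block (k + 1) @ block (k + 2))) = block k @ block (k + 1) @ block (k + 2)"
  using win_block[of k] win_block[of "Suc k"] win_block[of "Suc (Suc k)"]
  by (simp add: win_append block_pos_Suc add.assoc)

lemma block_pos_cover:
  obtains k r where "i = block_pos k + r" "r < length (block k)"
    "i mod 239 = (if even k then 0 else 114) + r"
proof (cases "i mod 239 < 114")
  case True
  then show ?thesis
    using that[of "2 * (i div 239)" "i mod 239"] by (simp add: block_pos_def length_block)
next
  case False
  have "i mod 239 < 239" by simp
  with False show ?thesis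
    using that[of "2 * (i div 239) + 1" "i mod 239 - 114"] mult_div_mod_eq[of 239 i]
    by (simp add: block_pos_def length_block)
qed

text \<open>Any two consecutive blocks have total length 239, so the window ends no later than the
  second block after the one in which it starts.\<close>

lemma win_in_all_windows:
  assumes "W \<le> 239"
  shows "(int (i mod 239), win i W) \<in> set (all_windows W)"
proof -
  obtain k r where i: "i = block_pos k + r" and r: "r < length (block k)"
    and m: "i mod 239 = (if even k then 0 else 114) + r"
    by (rule block_pos_cover)
  have "W \<le> length (block k @ block (k + 1) @ block (k + 2)) - r"
    using assms r by (auto simp: length_block)
  then have "win i W = take W (drop r (win (block_pos k) (length (block k @ block (k + 1) @ block (k + 2)))))"
    using r by (simp add: i drop_win take_win min_absorb1)
  also have "\<dots> = take W (drop r (block k) @ block (k + 1) @ block (k + 2))"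
    unfolding win_blocks using r by simp
  finally have eq: "win i W = take W (drop r (block k) @ block (k + 1) @ block (k + 2))" .
  show ?thesis
  proof (cases "even k")
    case True
    then have "(0 + int r, win i W) \<in> set (windows W 125 ablocks bblocks 114 0 ablocks)"
      unfolding eq using block_in[of k] block_in[of "k + 1"] block_in[of "k + 2"] r
      by (intro windows_sound) (auto simp: length_block)
    then show ?thesis
      using True m by (simp add: all_windows_def)
  next
    case False
    then have "(114 + int r, win i W) \<in> set (windows W 114 bblocks ablocks 125 114 bblocks)"
      unfolding eq using block_in[of k] block_in[of "k + 1"] block_in[of "k + 2"] r
      by (intro windows_sound) (auto simp: length_block)
    then show ?thesis
      using False m by (simp add: all_windows_def)
  qed
qed

lemma win_in_trie:
  assumes "W \<le> 239"
  shows "in_trie (mk_trie W (all_windows W)) (win i n)"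
  by (rule in_mk_trie[OF win_in_all_windows[OF assms]]) (auto simp: compat_iff take_win min.commute)

lemma win_split: "u @ v = win i n \<Longrightarrow> u = win i (length u) \<and> v = win (i + length u) (length v)"
  by (metis append_eq_append_conv length_append length_win win_append)

definition fac :: "bool list \<Rightarrow> bool" where
  "fac u \<longleftrightarrow> (\<exists>i. u = win i (length u))"

lemma fac_win: "fac (win i n)"
  by (auto simp: fac_def)

lemma fac_append: "fac (u @ v) \<Longrightarrow> fac u \<and> fac v"
  unfolding fac_def by (metis append_eq_append_conv length_append length_win win_append)

lemma is_factor_imp_fac: "is_factor u wseq \<Longrightarrow> fac u"
proof -
  assume "is_factor u wseq"
  then obtain i j where "i \<le> j" "u = subsequence wseq i j"
    unfolding is_factor_def by blast
  then have "u = win i (j - i)"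
    by (intro nth_equalityI) (auto simp: subsequence_def)
  then show ?thesis by (simp add: fac_win)
qed

section \<open>Reversible factors, and equal factors at different positions\<close>

fun no_reversal :: "bool \<Rightarrow> trie \<Rightarrow> (int \<times> bool list) list \<Rightarrow> bool" where
  "no_reversal True T its = False"
| "no_reversal False T [] = True"
| "no_reversal False T ((i, x) # its) = no_reversal (in_trie T (revapp x [])) T its"

lemma no_reversalD: "no_reversal b T its \<Longrightarrow> \<not> b \<and> (\<forall>(i, x)\<in>set its. \<not> in_trie T (rev x))"
  by (induction b T its rule: no_reversal.induct) (auto simp: revapp_eq)

lemma no_reversal: "no_reversal False (mk_trie 11 (all_windows 11)) (all_windows 11)"
  by code_simp

lemma reversible_short:
  assumes "fac y" "fac (rev y)"
  shows "length y \<le> 10"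
proof (rule ccontr)
  assume long: "\<not> length y \<le> 10"
  have split: "y = take 11 y @ drop 11 y" "rev y = rev (drop 11 y) @ rev (take 11 y)"
    by (simp_all flip: rev_append)
  have "length (take 11 y) = 11"
    using long by simp
  then obtain i j where "take 11 y = win i 11" "rev (take 11 y) = win j 11"
    using fac_append[of "take 11 y" "drop 11 y"] fac_append[of "rev (drop 11 y)" "rev (take 11 y)"] assms split
    unfolding fac_def by (metis length_rev)
  then have "in_trie (mk_trie 11 (all_windows 11)) (rev (win i 11))"
    using win_in_trie[of 11 j 11] by simp
  then show False
    using no_reversalD[OF no_reversal] win_in_all_windows[of 11 i] by auto
qed

lemma separated_windows: "separated 85 0 (all_windows 86)"
  by code_simp

lemma win_separated:
  assumes "win i e = win j e" "i mod 239 \<noteq> j mod 239" "43 \<le> e"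
  shows "e < 85 \<and> pos_ok (int e) (int (i mod 239)) (int (j mod 239))"
proof -
  \<comment> \<open>The cap at the length of the computed windows loses nothing:
    \<open>e' < 85\<close> rules out that it was effective.\<close>
  define e' where "e' = min e 86"
  have eq: "take e' (win i 86) = take e' (win j 86)"
    using arg_cong[OF assms(1), of "take e'"] by (simp add: take_win e'_def min.commute)
  have "pos_ok (0 + int e') (int (i mod 239)) (int (j mod 239)) \<and> e' < 85"
    by (rule separated_sound[OF separated_windows win_in_all_windows win_in_all_windows])
       (use assms eq in \<open>auto simp: e'_def\<close>)
  then show ?thesis
    by (auto simp: e'_def min_def split: if_splits)
qed

section \<open>Applying the search to the word\<close>

lemma length_needs: "length needs = 101"
  by code_simp

lemma nth_needs:
  assumes "4 \<le> P" "P < 105"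
  shows "needs ! (P - 4) = max 1 ((P - 19) div 2)"
proof -
  have "\<forall>P\<in>set [4..<105]. needs ! (P - 4) = max 1 ((P - 19) div 2)"
    by code_simp
  moreover have "P \<in> set [4..<105]"
    using assms by (simp del: upt_rec_numeral)
  ultimately show ?thesis by blast
qed

text \<open>Lets the evaluation proceed position by position while the argument refers to the full
  list of windows.\<close>

lemma check_windows_iff:
  "check_windows ns P T1 T2 W ld cs ds n pos sufs \<longleftrightarrow>
     excluded False T2 (survivors T1 ns P (windows W ld cs ds n pos sufs))"
  by (induction n arbitrary: pos sufs)
     (simp_all add: andb_eq excluded_iff set_survivors ball_Un del: continuations.simps)

lemma check_range_iff:
  "check_range W P k T1 T2 \<longleftrightarrow>
     excluded False T2 (survivors T1 (take k (drop (P - 4) needs)) P (all_windows W))"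
  by (simp add: check_windows_iff andb_eq excluded_iff set_survivors all_windows_def ball_Un
      initial_eq final_eq del: windows.simps)

text \<open>A factor passes every trie test, whereas a successful check means that each query fails
  one.\<close>

lemma query_not_fac:
  assumes "check_range W P k (mk_trie 24 (all_windows 24)) (mk_trie 86 (all_windows 86))" "W \<le> 239"
    and "(S, L, S', L', p, q) \<in> set (scan (win i W) (take k (drop (P - 4) needs))
        (drop P (win i W)) (rev (take P (win i W))))"
    and "S = S1 @ S'" "L = L1 @ L'"
  shows "\<not> fac (S @ p @ L @ q @ S)"
proof
  assume fac: "fac (S @ p @ L @ q @ S)"
  have trie: "in_trie (mk_trie n (all_windows n)) t" if "fac t" "n \<le> 239" for t n
  proof -
    obtain j where "t = win j (length t)"
      using \<open>fac t\<close> by (auto simp: fac_def)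
    then show ?thesis
      using win_in_trie[OF \<open>n \<le> 239\<close>, of j "length t"] by simp
  qed
  have "all_suffixes True (mk_trie 86 (all_windows 86)) (S @ p @ L @ q @ S)"
  proof (rule all_suffixes_if)
    have "fac (drop n u)" if "fac u" for n u
      using \<open>fac u\<close> fac_append[of "take n u" "drop n u"] by simp
    then show "in_trie (mk_trie 86 (all_windows 86)) (drop n (S @ p @ L @ q @ S))" for n
      using fac by (intro trie) (simp_all del: drop_append)
  qed
  moreover have "fac (p @ L @ q @ S)"
    using fac fac_append by blast
  moreover have "fac (p @ L)" "fac (L' @ q @ S)" "fac (S' @ p @ L)"
    using fac fac_append[of "S @ p @ L1" "L' @ q @ S"] fac_append[of S1 "S' @ p @ L @ q @ S"]
      fac_append[of "S' @ p @ L" "q @ S"] fac_append[of S' "p @ L"] assms(4,5) by auto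
  moreover have "excluded False (mk_trie 86 (all_windows 86)) (prefilter (mk_trie 24 (all_windows 24))
     (scan (win i W) (take k (drop (P - 4) needs)) (drop P (win i W)) (rev (take P (win i W)))))"
    using assms(1)[unfolded check_range_iff] win_in_all_windows[OF assms(2), of i]
    unfolding excluded_iff set_survivors by blast
  then have "\<not> (in_trie (mk_trie 24 (all_windows 24)) (p @ L) \<and>
       in_trie (mk_trie 24 (all_windows 24)) (L' @ q @ S) \<and>
       in_trie (mk_trie 24 (all_windows 24)) (S' @ p @ L)) \<or>
     \<not> all_suffixes (in_trie (mk_trie 86 (all_windows 86)) (p @ L @ q @ S))
       (mk_trie 86 (all_windows 86)) (S @ p @ L @ q @ S)"
    using assms(3) by (fastforce simp: excluded_iff set_prefilter)
  moreover have "in_trie (mk_trie 24 (all_windows 24)) t" "in_trie (mk_trie 86 (all_windows 86)) t"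
    if "fac t" for t
    using trie[OF that] by simp_all
  ultimately show False by simp
qed

text \<open>As \<open>P \<le> 2 * length L + 20\<close>, the excess \<open>length L\<close> reaches
  the demanded minimum, so the scan meets this repetition unless the window ends first.\<close>

lemma scan_complete:
  assumes frag: "L @ a @ S @ y @ L = win i (P + length L)"
    and P: "P = length L + 2 * length a + length S" and P0: "4 \<le> P0" "P0 \<le> P" "P < P0 + k" "P < 105"
    and ne: "L \<noteq> []" "a \<noteq> []" "S \<noteq> []" and le: "length S \<le> length L" "length a \<le> 10"
    and y: "y = a \<or> y = rev a"
    and pq: "(p, q) \<in> {(a, rev a), (rev a, a), (rev a, rev a)} \<or> y = rev a \<and> (p, q) = (a, a)"
  shows "{([], [], [], [], [], []), query S L (p, q)} \<inter>
    set (scan (win i W) (take k (drop (P0 - 4) needs)) (drop P0 (win i W)) (rev (take P0 (win i W)))) \<noteq> {}"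
    (is "_ \<inter> set (scan ?v ?ns ?u ?mr) \<noteq> {}")
proof -
  define j where "j = P - P0"
  define n where "n = needs ! (P - 4)"
  define l where "l = length L"
  define b where "b = length a"
  have leny: "length y = b"
    using y by (auto simp: b_def)
  have j: "j < length ?ns"
    using P0 length_needs by (simp add: j_def) linarith
  have n: "?ns ! j = n"
    using P0 j by (simp add: n_def j_def length_needs)
  have n': "n = max 1 ((P - 19) div 2)"
    using P0 unfolding n_def by (intro nth_needs) auto
  have "l \<ge> 1"
    using ne by (cases L) (auto simp: l_def)
  moreover have "P \<le> 2 * l + 20"
    using P le by (simp add: l_def)
  ultimately have nl: "n \<le> l"
    unfolding n' by linarith
  have run: "wseq (i + t) = wseq (i + P + t)" if "t < l" for t
  proof -
    have "take l (win i (P + length L)) = L" "drop P (win i (P + length L)) = L"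
      unfolding frag[symmetric] using P leny by (simp_all add: l_def b_def)
    then have "win i l = win (i + P) l"
      by (simp add: take_win drop_win l_def)
    then show ?thesis
      using that by (metis nth_win)
  qed
  show ?thesis
  proof (cases "j < length ?u")
    case False
    then show ?thesis
      using j scan_exhausted[of ?u ?ns ?v ?mr] by simp
  next
    case True
    then have PW: "P < W"
      using P0 by (simp add: j_def)
    define u where "u = win (i + P) (W - P)"
    define mr where "mr = rev (win i P)"
    have u: "drop j ?u = u"
      using P0 by (simp add: drop_win u_def j_def)
    have mr: "rev (take j ?u) @ ?mr = mr"
    proof -
      have "take P0 ?v @ take j ?u = win i P"
        using P0 PW by (simp add: take_win drop_win j_def min_absorb1 flip: win_append)
      then show ?thesis
        by (simp add: mr_def flip: rev_append)
    qed
    have "agree n ?v u"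
      by (rule agree_if) (use nl run in \<open>auto simp: u_def\<close>)
    then have sub: "set (extend True (rev (take n ?v)) (drop n ?v) (drop n u) (take 10 mr) mr)
        \<subseteq> set (scan ?v ?ns ?u ?mr)"
      using scan_hit[OF j True, of ?v ?mr] unfolding n u mr
      by (simp add: initial_eq final_eq revapp_eq)
    \<comment> \<open>The extension stops at the end of the window; reaching that end gives the
      query of empty words, otherwise all of \<open>L\<close> has been read.\<close>
    define k' where "k' = min (l - n) (length (drop n u))"
    have k'u: "k' \<le> length (drop n u)" and k'v: "k' \<le> length (drop n ?v)"
      using PW by (auto simp: k'_def u_def)
    have "take k' (drop n ?v) = take k' (drop n u)"
    proof (rule nth_equalityI)
      show "length (take k' (drop n ?v)) = length (take k' (drop n u))"
        using k'u k'v by simp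
      fix t assume "t < length (take k' (drop n ?v))"
      then show "take k' (drop n ?v) ! t = take k' (drop n u) ! t"
        using run[of "n + t"] k'u k'v by (auto simp: k'_def u_def add.assoc)
    qed
    note ext = extend_sound[OF this k'v k'u, of "rev (take n ?v)" "take 10 mr" mr]
    show ?thesis
    proof (cases "k' = length (drop n ?v) \<or> k' = length (drop n u)")
      case True
      then show ?thesis using ext sub by auto
    next
      case False
      then have k': "k' = l - n" and "l < W - P"
        using k'u by (auto simp: k'_def u_def)
      then have lW: "P + l < W"
        by simp
      have v: "?v = L @ a @ S @ y @ L @ win (i + (P + l)) (W - (P + l))"
        using win_append[of i "P + l" "W - (P + l)"] lW frag by (simp add: l_def)
      have vL: "take l ?v = L" and vd: "drop l ?v = a @ S @ y @ L @ win (i + (P + l)) (W - (P + l))"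
        unfolding v by (simp_all add: l_def)
      have mr': "mr = rev y @ rev S @ rev a @ rev L"
      proof -
        have "win i P = take P (win i (P + length L))"
          by (simp add: take_win)
        also have "\<dots> = L @ a @ S @ y"
          unfolding frag[symmetric] using P leny by (simp add: b_def)
        finally show ?thesis by (simp add: mr_def)
      qed
      have "rev (rev (take n ?v)) @ take k' (drop n ?v) = L"
        using vL nl by (simp add: k' flip: take_add)
      moreover have "drop k' (drop n ?v) = drop l ?v"
        using nl by (simp add: k')
      ultimately have cand: "set (candidates L (drop l ?v) mr
          (ywords True [] [] (take 10 (drop l ?v)) (take 10 (drop l ?v)) (take 10 mr) (drop l mr)))
          \<subseteq> set (scan ?v ?ns ?u ?mr)"
        using ext sub False nl lW by (auto simp: k')
      have tb: "take b (take 10 (drop l ?v)) = a" "take b (take 10 mr) = rev y"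
        unfolding vd mr' using le leny by (simp_all add: b_def min_absorb1)
      have "(rev (take b (take 10 (drop l ?v))) @ [], True \<and> take b (take 10 (drop l ?v)) = take b (take 10 mr))
         \<in> set (ywords True [] [] (take 10 (drop l ?v)) (take 10 (drop l ?v)) (take 10 mr) (drop l mr))"
      proof (rule ywords_sound)
        show "0 < b" using ne by (simp add: b_def)
        show "2 * b < length (drop l mr)"
        proof -
          have "length mr = P" "0 < length S"
            using ne by (simp_all add: mr_def)
          then show ?thesis
            using P by (simp add: b_def l_def)
        qed
        show "b \<le> length (take 10 (drop l ?v))" "b \<le> length (take 10 mr)"
          unfolding vd mr' using le leny by (simp_all add: b_def)
        show "True \<and> take b (take 10 (drop l ?v)) = take b (take 10 mr) \<or>
            compat (rev (take b (take 10 mr)) @ []) (take 10 (drop l ?v))"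
          unfolding tb using y leny le tb(1) by (auto simp: compat_iff b_def vd)
      qed
      then have yw: "(rev a, a = rev y) \<in> set (ywords True [] [] (take 10 (drop l ?v)) (take 10 (drop l ?v)) (take 10 mr) (drop l mr))"
        unfolding tb by simp
      have "query S L (p, q) \<in> set (candidates L (drop l ?v) mr
          (ywords True [] [] (take 10 (drop l ?v)) (take 10 (drop l ?v)) (take 10 mr) (drop l mr)))"
        by (rule candidates_sound[OF yw])
           (use ne le pq leny in \<open>auto simp: mr' vd b_def\<close>)
      then show ?thesis using cand by auto
    qed
  qed
qed

lemma no_short_period:
  assumes "check_range W P0 k (mk_trie 24 (all_windows 24)) (mk_trie 86 (all_windows 86))" "W \<le> 239"
    and "fac (L @ a @ S @ y @ L)" "fac (S @ p @ L @ q @ S)"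
    and P: "P = length L + 2 * length a + length S" and P0: "4 \<le> P0" "P0 \<le> P" "P < P0 + k" "P < 105"
    and ne: "L \<noteq> []" "a \<noteq> []" "S \<noteq> []" and le: "length S \<le> length L" "length a \<le> 10"
    and y: "y = a \<or> y = rev a"
    and pq: "(p, q) \<in> {(a, rev a), (rev a, a), (rev a, rev a)} \<or> y = rev a \<and> (p, q) = (a, a)"
  shows False
proof -
  have "length (L @ a @ S @ y @ L) = P + length L"
    using y P by auto
  then obtain i where "L @ a @ S @ y @ L = win i (P + length L)"
    using assms(3) unfolding fac_def by metis
  from scan_complete[OF this P P0 ne le y pq, of W]
  consider (short) "([], [], [], [], [], []) \<in> set (scan (win i W) (take k (drop (P0 - 4) needs))
        (drop P0 (win i W)) (rev (take P0 (win i W))))"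
    | (partner) "query S L (p, q) \<in> set (scan (win i W) (take k (drop (P0 - 4) needs))
        (drop P0 (win i W)) (rev (take P0 (win i W))))"
    by blast
  then show False
  proof cases
    case short
    \<comment> \<open>The empty word is a factor, so a successful check cannot have met the query of
      empty words.\<close>
    have "fac []"
      using fac_win[of 0 0] by (simp add: win_def)
    with query_not_fac[OF assms(1,2) short, of "[]" "[]"] show False by simp
  next
    case partner
    obtain S1 L1 where "S = S1 @ end12 S" "L = L1 @ end12 L"
      using end12_suffix by metis
    with query_not_fac[OF assms(1,2) partner[unfolded query_def prod.case]] assms(4) show False
      by blast
  qed
qed

subsection \<open>Long periods\<close>

text \<open>Each kind of block has two short segments that tell its three blocks apart; a run
  starting too late for the first may still contain the second.\<close>

lemma block_segments:
  assumes "(bs, s, n) \<in> {(ablocks, 47, 2), (ablocks, 66, 4), (bblocks, 48, 2), (bblocks, 71, 4)}"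
    and "a < 3" "b < 3" "take n (drop s (bs ! a)) = take n (drop s (bs ! b))"
  shows "a = b"
proof -
  have "\<forall>(bs, s, n)\<in>set [(ablocks, 47, 2), (ablocks, 66, 4), (bblocks, 48, 2), (bblocks, 71, 4)].
    \<forall>a\<in>set [0, 1, 2]. \<forall>b\<in>set [0, 1, 2]. take n (drop s (bs ! a)) = take n (drop s (bs ! b)) \<longrightarrow> a = b"
    by code_simp
  moreover have "a \<in> set [0, 1, 2]" "b \<in> set [0, 1, 2]"
    using assms(2,3) by auto
  ultimately show ?thesis
    using assms(1,4) by fastforce
qed

text \<open>A shift by \<open>239 * J\<close> carries block \<open>k\<close> to block
  \<open>k + 2 * J\<close>, which is of the same kind.\<close>

lemma tseq_determined:
  assumes run: "\<And>t. t < e \<Longrightarrow> wseq (i + t) = wseq (i + 239 * J + t)"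
    and seg: "(s, n) \<in> (if even k then {(47, 2), (66, 4)} else {(48, 2), (71, 4)})"
    and inside: "i \<le> block_pos k + s" "block_pos k + s + n \<le> i + e"
  shows "tseq k = tseq (k + 2 * J)"
proof -
  have seg_win: "take n (drop s (block k')) = win (block_pos k' + s) n" if "even k' = even k" for k'
  proof -
    have "s + n \<le> length (block k')"
      using seg that by (auto simp: length_block split: if_splits)
    then show ?thesis
      by (subst win_block[symmetric]) (simp add: drop_win take_win)
  qed
  have "block_pos (k + 2 * J) = block_pos k + 239 * J"
    by (simp add: block_pos_def)
  then have "win (block_pos k + s) n = win (block_pos (k + 2 * J) + s) n"
  proof (intro nth_equalityI)
    fix t assume "t < length (win (block_pos k + s) n)"
    then show "win (block_pos k + s) n ! t = win (block_pos (k + 2 * J) + s) n ! t"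
      using run[of "block_pos k + s - i + t"] inside \<open>block_pos (k + 2 * J) = _\<close> by (simp add: ac_simps)
  qed simp
  then have "take n (drop s (block k)) = take n (drop s (block (k + 2 * J)))"
    using seg_win[of k] seg_win[of "k + 2 * J"] by simp
  moreover have "((if even k then ablocks else bblocks), s, n) \<in>
      {(ablocks, 47, 2), (ablocks, 66, 4), (bblocks, 48, 2), (bblocks, 71, 4)}"
    using seg by (auto split: if_splits)
  ultimately show ?thesis
    using block_segments tseq_less unfolding block_def by (simp del: insert_iff)
qed

text \<open>A run of at least \<open>239 * J / 2 - 10\<close> letters is nearly as long as
  \<open>J\<close> blocks, whose mean length is 239 / 2. It contains a distinguishing segment of
  each of \<open>J\<close> consecutive blocks, against \<open>tseq_no_run\<close>.\<close>

lemma multiple_period: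
  assumes run: "\<And>t. t < e \<Longrightarrow> wseq (i + t) = wseq (i + 239 * J + t)" and "0 < J"
  shows "2 * e + 20 < 239 * J"
proof (rule ccontr)
  assume "\<not> 2 * e + 20 < 239 * J"
  then have e: "239 * J \<le> 2 * e + 20" by simp
  define q where "q = i div 239"
  define r where "r = i mod 239"
  have i: "i = 239 * q + r" "r < 239"
    by (simp_all add: q_def r_def)
  have even_pos: "block_pos (2 * m) = 239 * m" and odd_pos: "block_pos (2 * m + 1) = 239 * m + 114" for m
    by (simp_all add: block_pos_def)
  have detA: "tseq (2 * m) = tseq (2 * m + 2 * J)"
    if "i \<le> 239 * m + 47 \<and> 239 * m + 49 \<le> i + e \<or> i \<le> 239 * m + 66 \<and> 239 * m + 70 \<le> i + e" for m
    using that tseq_determined[where e = e and i = i and J = J, OF run, where s = 47 and n = 2 and k = "2 * m"]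
      tseq_determined[where e = e and i = i and J = J, OF run, where s = 66 and n = 4 and k = "2 * m"] unfolding even_pos by (auto simp: ac_simps)
  have detB: "tseq (2 * m + 1) = tseq (2 * m + 1 + 2 * J)"
    if "i \<le> 239 * m + 162 \<and> 239 * m + 164 \<le> i + e \<or> i \<le> 239 * m + 185 \<and> 239 * m + 189 \<le> i + e" for m
    using that tseq_determined[where e = e and i = i and J = J, OF run, where s = 48 and n = 2 and k = "2 * m + 1"]
      tseq_determined[where e = e and i = i and J = J, OF run, where s = 71 and n = 4 and k = "2 * m + 1"] unfolding odd_pos by (auto simp: ac_simps)
  have "\<exists>k. \<forall>j<J. tseq (k + j) = tseq (k + j + 2 * J)"
  proof -
    \<comment> \<open>66 and 185 = 114 + 71 are the last starts that leave the second segment of the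
      A block and of the B block intact.\<close>
    consider "r \<le> 66" | "67 \<le> r" "r \<le> 185" | "186 \<le> r"
      by linarith
    then show ?thesis
    proof cases
      case 1
      have "tseq (2 * q + j) = tseq (2 * q + j + 2 * J)" if "j < J" for j
      proof (cases "even j")
        case True
        then obtain h where j: "j = 2 * h" ..
        have "i \<le> 239 * (q + h) + 66 \<and> 239 * (q + h) + 70 \<le> i + e"
          using i 1 e that j by (simp add: distrib_left)
        with detA[of "q + h"] show ?thesis by (simp add: j algebra_simps)
      next
        case False
        then obtain h where j: "j = 2 * h + 1" by (rule oddE)
        have "i \<le> 239 * (q + h) + 162 \<and> 239 * (q + h) + 164 \<le> i + e"
          using i 1 e that j by (simp add: distrib_left)
        with detB[of "q + h"] show ?thesis by (simp add: j algebra_simps)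
      qed
      then show ?thesis by blast
    next
      case 2
      have "tseq (2 * q + 1 + j) = tseq (2 * q + 1 + j + 2 * J)" if "j < J" for j
      proof (cases "even j")
        case True
        then obtain h where j: "j = 2 * h" ..
        have "i \<le> 239 * (q + h) + 162 \<and> 239 * (q + h) + 164 \<le> i + e \<or> i \<le> 239 * (q + h) + 185 \<and> 239 * (q + h) + 189 \<le> i + e"
        proof (cases "r \<le> 162")
          case True
          then have "i \<le> 239 * (q + h) + 162 \<and> 239 * (q + h) + 164 \<le> i + e"
            using i 2 e that j by (simp add: distrib_left)
          then show ?thesis ..
        next
          case False
          then have "i \<le> 239 * (q + h) + 185 \<and> 239 * (q + h) + 189 \<le> i + e"
            using i 2 e that j by (simp add: distrib_left)
          then show ?thesis ..
        qed
        from detB[OF this] show ?thesis by (simp add: j algebra_simps)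
      next
        case False
        then obtain h where j: "j = 2 * h + 1" by (rule oddE)
        have "i \<le> 239 * (q + h + 1) + 47 \<and> 239 * (q + h + 1) + 49 \<le> i + e"
          using i 2 e that j by (simp add: distrib_left)
        with detA[of "q + h + 1"] show ?thesis by (simp add: j algebra_simps)
      qed
      then show ?thesis by blast
    next
      case 3
      have "tseq (2 * q + 2 + j) = tseq (2 * q + 2 + j + 2 * J)" if "j < J" for j
      proof (cases "even j")
        case True
        then obtain h where j: "j = 2 * h" ..
        have "i \<le> 239 * (q + h + 1) + 47 \<and> 239 * (q + h + 1) + 49 \<le> i + e"
          using i 3 e that j by (simp add: distrib_left)
        with detA[of "q + h + 1"] show ?thesis by (simp add: j algebra_simps)
      next
        case False
        then obtain h where j: "j = 2 * h + 1" by (rule oddE)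
        have "i \<le> 239 * (q + h + 1) + 162 \<and> 239 * (q + h + 1) + 164 \<le> i + e"
          using i 3 e that j by (simp add: distrib_left)
        with detB[of "q + h + 1"] show ?thesis by (simp add: j algebra_simps)
      qed
      then show ?thesis by blast
    qed
  qed
  then show False
    using tseq_no_run[OF \<open>0 < J\<close>] by blast
qed

lemma mod_add_cases:
  fixes i P :: nat
  assumes "P < 239"
  shows "(i + P) mod 239 = (if i mod 239 + P < 239 then i mod 239 + P else i mod 239 + P - 239)"
proof -
  have "(i + P) mod 239 = (i mod 239 + P) mod 239"
    by (simp add: mod_simps)
  moreover have "i mod 239 + P - 239 < 239"
    using assms mod_less_divisor[of 239 i] by linarith
  ultimately show ?thesis
    by (auto simp: le_mod_geq)
qed

text \<open>If 239 does not divide \<open>P\<close>, the positions differ modulo 239, so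
  \<open>e < 85\<close> and \<open>P \<le> 188\<close>. Their distance is \<open>P\<close> or, after
  wrapping around, \<open>239 - P\<close>; \<open>pos_ok\<close> leaves only 177 without
  wrapping.\<close>

lemma long_period:
  assumes run: "win i e = win (i + P) e" and P: "105 \<le> P" and e: "P \<le> 2 * e + 20"
  shows "P = 177 \<and> e < 85 \<and> 53 \<le> i mod 239 \<and> i mod 239 \<le> 61"
proof -
  have "\<not> 239 dvd P"
  proof
    assume "239 dvd P"
    then obtain J where J: "P = 239 * J" ..
    have "wseq (i + t) = wseq (i + 239 * J + t)" if "t < e" for t
      using arg_cong[OF run, of "\<lambda>xs. xs ! t"] that J by simp
    then have "2 * e + 20 < 239 * J"
      using P J by (intro multiple_period) auto
    with e J show False by simp
  qed
  then have "i mod 239 \<noteq> (i + P) mod 239"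
    by (metis add_diff_cancel_left' le_add1 mod_eq_dvd_iff_nat)
  from win_separated[OF run this] have e85: "e < 85"
    and ok: "pos_ok (int e) (int (i mod 239)) (int ((i + P) mod 239))"
    using P e by auto
  have "P < 239"
    using e e85 by simp
  have lt: "i mod 239 < 239" by simp
  show ?thesis
  proof (cases "i mod 239 + P < 239")
    case True
    then have "(i + P) mod 239 = i mod 239 + P"
      using mod_add_cases[OF \<open>P < 239\<close>, of i] by simp
    then show ?thesis
      using ok P e e85 by (auto simp: pos_ok_def)
  next
    case False
    then have eq: "(i + P) mod 239 = i mod 239 + P - 239"
      using mod_add_cases[OF \<open>P < 239\<close>, of i] by simp
    have "\<bar>int (i mod 239) - int ((i + P) mod 239)\<bar> = 239 - int P"
      unfolding eq using False \<open>P < 239\<close> by (simp add: of_nat_diff)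
    then show ?thesis
      using ok P e \<open>P < 239\<close> unfolding pos_ok_def by auto
  qed
qed

text \<open>The first fragment forces \<open>P = 177\<close>, so \<open>S\<close> has at least 177 -
  84 - 20 = 73 letters and the list of coincidences in \<open>pos_ok\<close> applies to it as
  well.\<close>

lemma no_long_period:
  assumes "fac (L @ a @ S @ y @ L)" "fac (S @ p @ L @ q @ S)"
    and P: "P = length L + 2 * length a + length S" "105 \<le> P"
    and "a \<noteq> []" and le: "length S \<le> length L" "length a \<le> 10"
    and len: "length y = length a" "length p = length a" "length q = length a"
  shows False
proof -
  define l b s where "l = length L" and "b = length a" and "s = length S"
  have P': "P = l + 2 * b + s"
    using P by (simp add: l_def b_def s_def)
  have P_eq: "i + l + b + s + b = i + P" "i + s + b + l + b = i + P" for i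
    using P' by simp_all
  obtain i n where "L @ a @ S @ y @ L = win i n"
    using assms(1) unfolding fac_def by blast
  then have "L = win i l \<and> S = win (i + l + b) s \<and> L = win (i + l + b + s + b) l"
    using win_split[of L "a @ S @ y @ L" i] win_split[of a "S @ y @ L"] win_split[of S "y @ L"] win_split[of y L]
    unfolding l_def b_def s_def by (metis len(1))
  then have i: "L = win i l" "S = win (i + l + b) s" "L = win (i + P) l"
    unfolding P_eq by blast+
  obtain j n where "S @ p @ L @ q @ S = win j n"
    using assms(2) unfolding fac_def by blast
  then have "S = win j s \<and> S = win (j + s + b + l + b) s"
    using win_split[of S "p @ L @ q @ S" j] win_split[of p "L @ q @ S"] win_split[of L "q @ S"] win_split[of q S]
    unfolding l_def b_def s_def by (metis len(2,3))
  then have j: "S = win j s" "S = win (j + P) s"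
    unfolding P_eq by blast+
  have "P \<le> 2 * l + 20"
    using P' le by (simp add: l_def b_def s_def)
  with long_period[of i l P] i P(2) have *: "P = 177" "l < 85" "53 \<le> i mod 239" "i mod 239 \<le> 61"
    by auto
  have b: "1 \<le> b" "b \<le> 10"
    using assms(5) le by (auto simp: b_def Suc_le_eq)
  have s: "73 \<le> s" "s \<le> l"
    using P' * b le by (auto simp: s_def l_def)
  \<comment> \<open>The two copies of \<open>S\<close> are at distance 177, or 62 after wrapping
    around; the first two entries of the list bound \<open>j\<close>.\<close>
  have jm: "53 \<le> j mod 239 \<and> j mod 239 \<le> 64"
  proof -
    have cases: "(j + 177) mod 239 = (if j mod 239 + 177 < 239 then j mod 239 + 177 else j mod 239 + 177 - 239)"
      by (rule mod_add_cases) simp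
    have "j mod 239 < 239" by simp
    then have ne: "j mod 239 \<noteq> (j + P) mod 239"
      unfolding * cases by auto
    have "pos_ok (int s) (int (j mod 239)) (int ((j + P) mod 239))"
      using win_separated[OF _ ne, of s] j s by auto
    then show ?thesis
      using ne s \<open>j mod 239 < 239\<close> unfolding pos_ok_def * cases by (auto split: if_splits)
  qed
  \<comment> \<open>This puts the \<open>S\<close> of the first fragment 78 to 111 places after
    \<open>j\<close> modulo 239, a distance missing from the list.\<close>
  have lb: "89 \<le> l + b" "l + b \<le> 103"
    using P' * s b by linarith+
  then have m: "(i + (l + b)) mod 239 = i mod 239 + (l + b)"
    using mod_add_cases[of "l + b" i] * by simp
  then have ne: "j mod 239 \<noteq> (i + (l + b)) mod 239"
    using jm lb * by linarith
  have "pos_ok (int s) (int (j mod 239)) (int ((i + (l + b)) mod 239))"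
    using win_separated[OF _ ne, of s] i(2) j s by (auto simp: add.assoc)
  then show False
    using ne s jm * lb unfolding pos_ok_def m by auto
qed

section \<open>Combining all periods, and reducing the five formulas to one pattern\<close>

lemma check_ranges: "check_ranges (mk_trie 24 (all_windows 24)) (mk_trie 86 (all_windows 86))"
  by code_simp

lemmas check_range = check_ranges[unfolded check_ranges.simps andb_eq]

lemma no_occurrence:
  assumes "fac (L @ a @ S @ y @ L)" "fac (S @ p @ L @ q @ S)"
    and ne: "L \<noteq> []" "a \<noteq> []" "S \<noteq> []" and le: "length S \<le> length L"
    and rev: "fac a" "fac (rev a)"
    and y: "y = a \<or> y = rev a"
    and pq: "(p, q) \<in> {(a, rev a), (rev a, a), (rev a, rev a)} \<or> y = rev a \<and> (p, q) = (a, a)"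
  shows False
proof -
  define P where "P = length L + 2 * length a + length S"
  have a: "length a \<le> 10"
    using rev by (rule reversible_short)
  have "length L \<ge> 1" "length a \<ge> 1" "length S \<ge> 1"
    using ne by (auto simp: Suc_le_eq)
  then have "4 \<le> P" by (simp add: P_def)
  note short = no_short_period[OF _ _ assms(1,2) P_def _ _ _ _ ne le a y pq]
  consider "P < 30" | "30 \<le> P" "P < 41" | "41 \<le> P" "P < 53" | "53 \<le> P" "P < 67" | "67 \<le> P" "P < 105" | "105 \<le> P"
    by linarith
  then show False
  proof cases
    case 1
    then show ?thesis using short[OF check_range[THEN conjunct1]] \<open>4 \<le> P\<close> by simp
  next
    case 2
    then show ?thesis using short[OF check_range[THEN conjunct2, THEN conjunct1]] by simp
  next
    case 3
    then show ?thesis using short[OF check_range[THEN conjunct2, THEN conjunct2, THEN conjunct1]] by simp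
  next
    case 4
    then show ?thesis using short[OF check_range[THEN conjunct2, THEN conjunct2, THEN conjunct2, THEN conjunct1]] by simp
  next
    case 5
    then show ?thesis using short[OF check_range[THEN conjunct2, THEN conjunct2, THEN conjunct2, THEN conjunct2]] by simp
  next
    case 6
    show ?thesis
      by (rule no_long_period[OF assms(1,2) P_def 6 ne(2) le a]) (use y pq in auto)
  qed
qed

lemma no_pair:
  assumes "fac (x @ y @ z @ y' @ x)" "fac (z @ p @ x @ q @ z)"
    and ne: "x \<noteq> []" "y \<noteq> []" "z \<noteq> []"
    and "y' = y \<and> (p, q) \<in> {(y, rev y), (rev y, y), (rev y, rev y)} \<or>
      y' = rev y \<and> (p, q) \<in> {(y, rev y), (rev y, y)}"
  shows False
proof -
  have "fac y"
    using fac_append[OF assms(1)] fac_append[of y] by blast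
  moreover have "fac (rev y)"
    using assms(6) fac_append[OF assms(2)] fac_append[of p] fac_append[of x] fac_append[of q] by blast
  ultimately have fy: "fac y" "fac (rev y)" .
  show False
  proof (cases "length z \<le> length x")
    case True
    then show False
      using assms(6) by (intro no_occurrence[OF assms(1,2) ne True fy]) auto
  next
    case False
    then have le: "length x \<le> length z" by simp
    \<comment> \<open>After the exchange, \<open>p\<close> takes the role of
      \<open>a\<close>.\<close>
    have "p = y \<or> p = rev y"
      using assms(6) by auto
    then show False
    proof
      assume "p = y"
      then show False
        using assms(6) ne fy le by (intro no_occurrence[OF assms(2,1)]) auto
    next
      assume "p = rev y"
      then show False
        using assms(6) ne fy le by (intro no_occurrence[OF assms(2,1)]) auto
    qed
  qed
qed

lemma avoids_pair:
  assumes "\<And>x y z. x \<noteq> [] \<Longrightarrow> y \<noteq> [] \<Longrightarrow> z \<noteq> [] \<Longrightarrow>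
      fac (subst_fragment (case_variable x y z) f) \<Longrightarrow> fac (subst_fragment (case_variable x y z) g) \<Longrightarrow> False"
  shows "avoids wseq {|f, g|}"
  unfolding avoids_def
proof
  assume "\<exists>h. is_occurrence h {|f, g|} wseq"
  then obtain h where h: "is_occurrence h {|f, g|} wseq" ..
  have "case_variable (h X) (h Y) (h Z) = h"
    by (rule ext) (auto split: variable.split)
  with h assms[of "h X" "h Y" "h Z"] show False
    by (auto simp: is_occurrence_def is_factor_imp_fac)
qed

theorem theorem2:
  shows "\<exists>w :: bool word.
    avoids w {| [Fwd X, Fwd Y, Fwd Z, Fwd Y, Fwd X], [Fwd Z, Fwd Y, Fwd X, Rev Y, Fwd Z] |} \<and>
    avoids w {| [Fwd X, Fwd Y, Fwd Z, Fwd Y, Fwd X], [Fwd Z, Rev Y, Fwd X, Fwd Y, Fwd Z] |} \<and>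
    avoids w {| [Fwd X, Fwd Y, Fwd Z, Fwd Y, Fwd X], [Fwd Z, Rev Y, Fwd X, Rev Y, Fwd Z] |} \<and>
    avoids w {| [Fwd X, Fwd Y, Fwd Z, Rev Y, Fwd X], [Fwd Z, Fwd Y, Fwd X, Rev Y, Fwd Z] |} \<and>
    avoids w {| [Fwd X, Fwd Y, Fwd Z, Rev Y, Fwd X], [Fwd Z, Rev Y, Fwd X, Fwd Y, Fwd Z] |}"
proof (intro exI[of _ wseq] conjI)
  show "avoids wseq {| [Fwd X, Fwd Y, Fwd Z, Fwd Y, Fwd X], [Fwd Z, Fwd Y, Fwd X, Rev Y, Fwd Z] |}"
    by (rule avoids_pair) (use no_pair in \<open>force simp: subst_fragment_def\<close>)
  show "avoids wseq {| [Fwd X, Fwd Y, Fwd Z, Fwd Y, Fwd X], [Fwd Z, Rev Y, Fwd X, Fwd Y, Fwd Z] |}"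
    by (rule avoids_pair) (use no_pair in \<open>force simp: subst_fragment_def\<close>)
  show "avoids wseq {| [Fwd X, Fwd Y, Fwd Z, Fwd Y, Fwd X], [Fwd Z, Rev Y, Fwd X, Rev Y, Fwd Z] |}"
    by (rule avoids_pair) (use no_pair in \<open>force simp: subst_fragment_def\<close>)
  show "avoids wseq {| [Fwd X, Fwd Y, Fwd Z, Rev Y, Fwd X], [Fwd Z, Fwd Y, Fwd X, Rev Y, Fwd Z] |}"
    by (rule avoids_pair) (use no_pair in \<open>force simp: subst_fragment_def\<close>)
  show "avoids wseq {| [Fwd X, Fwd Y, Fwd Z, Rev Y, Fwd X], [Fwd Z, Rev Y, Fwd X, Fwd Y, Fwd Z] |}"
    by (rule avoids_pair) (use no_pair in \<open>force simp: subst_fragment_def\<close>)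
qed

end
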